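(* Let $\Sigma$ be a many-sorted signature completely split into $\{\Sigma_\sigma:\sigma\in\mathcal{S}_\Sigma\}$, and let $\mathcal{T}$ be a $\Sigma$-theory all of whose models are strongly infinite. Suppose $\mathcal{T}$ is $\kappa$-categorical for some function $\kappa$ from $\mathcal{S}_\Sigma$ to cardinals with $\kappa(\sigma)\ge|\Sigma_\sigma|$ for every $\sigma\in\mathcal{S}_\Sigma$. Then $\mathcal{T}$ is complete.
   Context: Many-sorted first-order logic: a signature $\Sigma$ has a nonempty set $\mathcal{S}_\Sigma$ of sorts, a set $\mathcal{F}_\Sigma$ of function symbols and a set $\mathcal{P}_\Sigma$ of predicate symbols (including an equality symbol for each sort), with sorted arities; $|\Sigma|=|\mathcal{S}_\Sigma|+|\mathcal{F}_\Sigma|+|\mathcal{P}_\Sigma|$. A $\Sigma$-structure interprets each sort $\sigma$ as a nonempty set $\sigma^{\mathbb{A}}$. $\Sigma$ is completely split into $\{\Sigma_\sigma:\sigma\in\mathcal{S}_\Sigma\}$ if each $\Sigma_\sigma$ is a signature with the single sort $\sigma$, $\mathcal{F}_\Sigma=\bigcup_\sigma\mathcal{F}_{\Sigma_\sigma}$ and $\mathcal{P}_\Sigma=\bigcup_\sigma\mathcal{P}_{\Sigma_\sigma}$ (so every symbol only involves one sort). A structure $\mathbb{A}$ is strongly infinite if $|\sigma^{\mathbb{A}}|\ge\aleph_0$ for all sorts $\sigma$. A $\Sigma$-theory $\mathcal{T}$ (set of sentences) is $\kappa$-categorical, for $\kappa$ a function from $\mathcal{S}_\Sigma$ to cardinals,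 if it has exactly one model $\mathbb{A}$ up to isomorphism with $|\sigma^{\mathbb{A}}|=\kappa(\sigma)$ for every $\sigma$. $\mathcal{T}$ is complete if for every sentence $\varphi$, $\mathcal{T}\models\varphi$ or $\mathcal{T}\models\neg\varphi$. *)

theory Defs
  imports Main
begin

unbundle cardinal_syntax

section \<open>Many-sorted signatures\<close>

text \<open>
  The predicate symbols include one equality symbol for each sort; the field \<open>eqsym\<close> tells
  which one it is. Sorts, function symbols and predicate symbols are subsets of
  the types \<open>'s\<close>, \<open>'f\<close>, \<open>'p\<close>, and may be of arbitrary cardinality.
\<close>

record ('s, 'f, 'p) signature =
  sorts :: "'s set"
  funs :: "'f set"
  preds :: "'p set"
  farity :: "'f \<Rightarrow> 's list \<times> 's"
  parity :: "'p \<Rightarrow> 's list"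
  eqsym :: "'s \<Rightarrow> 'p"

definition wf_signature :: "('s, 'f, 'p) signature \<Rightarrow> bool" where
  "wf_signature \<Sigma> \<longleftrightarrow>
     sorts \<Sigma> \<noteq> {} \<and>
     (\<forall>f \<in> funs \<Sigma>. set (fst (farity \<Sigma> f)) \<subseteq> sorts \<Sigma> \<and> snd (farity \<Sigma> f) \<in> sorts \<Sigma>) \<and>
     (\<forall>p \<in> preds \<Sigma>. set (parity \<Sigma> p) \<subseteq> sorts \<Sigma>) \<and>
     (\<forall>\<sigma> \<in> sorts \<Sigma>. eqsym \<Sigma> \<sigma> \<in> preds \<Sigma> \<and> parity \<Sigma> (eqsym \<Sigma> \<sigma>) = [\<sigma>, \<sigma>])"

definition sig_card :: "('s, 'f, 'p) signature \<Rightarrow> ('s + 'f + 'p) rel" where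
  "sig_card \<Sigma> = |sorts \<Sigma>| +c ( |funs \<Sigma>| +c |preds \<Sigma>| )"

text \<open>
  \<open>farity\<close>, \<open>parity\<close> and \<open>eqsym\<close> are total functions, so the parts have to be told explicitly
  to agree with \<open>\<Sigma>\<close> on their own symbols.
\<close>

definition completely_split ::
    "('s, 'f, 'p) signature \<Rightarrow> ('s \<Rightarrow> ('s, 'f, 'p) signature) \<Rightarrow> bool" where
  "completely_split \<Sigma> \<Sigma>s \<longleftrightarrow>
     (\<forall>\<sigma> \<in> sorts \<Sigma>.
        wf_signature (\<Sigma>s \<sigma>) \<and> sorts (\<Sigma>s \<sigma>) = {\<sigma>} \<and>
        (\<forall>f \<in> funs (\<Sigma>s \<sigma>). farity (\<Sigma>s \<sigma>) f = farity \<Sigma> f) \<and>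
        (\<forall>p \<in> preds (\<Sigma>s \<sigma>). parity (\<Sigma>s \<sigma>) p = parity \<Sigma> p) \<and>
        eqsym (\<Sigma>s \<sigma>) \<sigma> = eqsym \<Sigma> \<sigma>) \<and>
     funs \<Sigma> = (\<Union>\<sigma> \<in> sorts \<Sigma>. funs (\<Sigma>s \<sigma>)) \<and>
     preds \<Sigma> = (\<Union>\<sigma> \<in> sorts \<Sigma>. preds (\<Sigma>s \<sigma>))"


section \<open>Terms, formulas, sentences\<close>

text \<open>A variable is a pair of a name and its sort, so each sort has countably many variables.\<close>

type_synonym 's var = "nat \<times> 's"

datatype ('s, 'f) trm =
    Var "'s var"
  | Fn 'f "('s, 'f) trm list"

datatype ('s, 'f, 'p) form =
    Rel 'p "('s, 'f) trm list"
  | Neg "('s, 'f, 'p) form"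
  | Conj "('s, 'f, 'p) form" "('s, 'f, 'p) form"
  | Disj "('s, 'f, 'p) form" "('s, 'f, 'p) form"
  | Imp "('s, 'f, 'p) form" "('s, 'f, 'p) form"
  | All "'s var" "('s, 'f, 'p) form"
  | Ex "'s var" "('s, 'f, 'p) form"

inductive has_sort :: "('s, 'f, 'p) signature \<Rightarrow> ('s, 'f) trm \<Rightarrow> 's \<Rightarrow> bool"
  for \<Sigma> where
    Var: "\<sigma> \<in> sorts \<Sigma> \<Longrightarrow> has_sort \<Sigma> (Var (n, \<sigma>)) \<sigma>"
  | Fn: "f \<in> funs \<Sigma> \<Longrightarrow> farity \<Sigma> f = (\<sigma>s, \<sigma>) \<Longrightarrow> list_all2 (has_sort \<Sigma>) ts \<sigma>s
         \<Longrightarrow> has_sort \<Sigma> (Fn f ts) \<sigma>"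

primrec wf_form :: "('s, 'f, 'p) signature \<Rightarrow> ('s, 'f, 'p) form \<Rightarrow> bool" where
  "wf_form \<Sigma> (Rel p ts) \<longleftrightarrow> p \<in> preds \<Sigma> \<and> list_all2 (has_sort \<Sigma>) ts (parity \<Sigma> p)"
| "wf_form \<Sigma> (Neg \<phi>) \<longleftrightarrow> wf_form \<Sigma> \<phi>"
| "wf_form \<Sigma> (Conj \<phi> \<psi>) \<longleftrightarrow> wf_form \<Sigma> \<phi> \<and> wf_form \<Sigma> \<psi>"
| "wf_form \<Sigma> (Disj \<phi> \<psi>) \<longleftrightarrow> wf_form \<Sigma> \<phi> \<and> wf_form \<Sigma> \<psi>"
| "wf_form \<Sigma> (Imp \<phi> \<psi>) \<longleftrightarrow> wf_form \<Sigma> \<phi> \<and> wf_form \<Sigma> \<psi>"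
| "wf_form \<Sigma> (All x \<phi>) \<longleftrightarrow> snd x \<in> sorts \<Sigma> \<and> wf_form \<Sigma> \<phi>"
| "wf_form \<Sigma> (Ex x \<phi>) \<longleftrightarrow> snd x \<in> sorts \<Sigma> \<and> wf_form \<Sigma> \<phi>"

primrec fv_trm :: "('s, 'f) trm \<Rightarrow> 's var set" where
  "fv_trm (Var x) = {x}"
| "fv_trm (Fn f ts) = \<Union> (set (map fv_trm ts))"

primrec fv :: "('s, 'f, 'p) form \<Rightarrow> 's var set" where
  "fv (Rel p ts) = (\<Union>t \<in> set ts. fv_trm t)"
| "fv (Neg \<phi>) = fv \<phi>"
| "fv (Conj \<phi> \<psi>) = fv \<phi> \<union> fv \<psi>"
| "fv (Disj \<phi> \<psi>) = fv \<phi> \<union> fv \<psi>"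
| "fv (Imp \<phi> \<psi>) = fv \<phi> \<union> fv \<psi>"
| "fv (All x \<phi>) = fv \<phi> - {x}"
| "fv (Ex x \<phi>) = fv \<phi> - {x}"

definition sentence :: "('s, 'f, 'p) signature \<Rightarrow> ('s, 'f, 'p) form \<Rightarrow> bool" where
  "sentence \<Sigma> \<phi> \<longleftrightarrow> wf_form \<Sigma> \<phi> \<and> fv \<phi> = {}"

definition is_theory :: "('s, 'f, 'p) signature \<Rightarrow> ('s, 'f, 'p) form set \<Rightarrow> bool" where
  "is_theory \<Sigma> T \<longleftrightarrow> (\<forall>\<phi> \<in> T. sentence \<Sigma> \<phi>)"


section \<open>Structures and satisfaction\<close>

text \<open>
  The domains are subsets of a universe type \<open>'u\<close>; different sorts may have overlapping domains.
  Only the values of \<open>fint\<close> and \<open>pint\<close> on argument lists of the right sorts matter.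
\<close>

record ('s, 'f, 'p, 'u) struct =
  dom :: "'s \<Rightarrow> 'u set"
  fint :: "'f \<Rightarrow> 'u list \<Rightarrow> 'u"
  pint :: "'p \<Rightarrow> 'u list \<Rightarrow> bool"

definition args :: "('s, 'f, 'p, 'u) struct \<Rightarrow> 's list \<Rightarrow> 'u list set" where
  "args A \<sigma>s = {as. list_all2 (\<lambda>a \<sigma>. a \<in> dom A \<sigma>) as \<sigma>s}"

definition is_structure ::
    "('s, 'f, 'p) signature \<Rightarrow> ('s, 'f, 'p, 'u) struct \<Rightarrow> bool" where
  "is_structure \<Sigma> A \<longleftrightarrow>
     (\<forall>\<sigma> \<in> sorts \<Sigma>. dom A \<sigma> \<noteq> {}) \<and>
     (\<forall>f \<in> funs \<Sigma>. \<forall>as \<in> args A (fst (farity \<Sigma> f)). fint A f as \<in> dom A (snd (farity \<Sigma> f))) \<and>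
     (\<forall>\<sigma> \<in> sorts \<Sigma>. \<forall>a \<in> dom A \<sigma>. \<forall>b \<in> dom A \<sigma>. pint A (eqsym \<Sigma> \<sigma>) [a, b] \<longleftrightarrow> a = b)"

primrec eval :: "('s, 'f, 'p, 'u) struct \<Rightarrow> ('s var \<Rightarrow> 'u) \<Rightarrow> ('s, 'f) trm \<Rightarrow> 'u" where
  "eval A v (Var x) = v x"
| "eval A v (Fn f ts) = fint A f (map (eval A v) ts)"

primrec sat :: "('s, 'f, 'p, 'u) struct \<Rightarrow> ('s var \<Rightarrow> 'u) \<Rightarrow> ('s, 'f, 'p) form \<Rightarrow> bool" where
  "sat A v (Rel p ts) \<longleftrightarrow> pint A p (map (eval A v) ts)"
| "sat A v (Neg \<phi>) \<longleftrightarrow> \<not> sat A v \<phi>"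
| "sat A v (Conj \<phi> \<psi>) \<longleftrightarrow> sat A v \<phi> \<and> sat A v \<psi>"
| "sat A v (Disj \<phi> \<psi>) \<longleftrightarrow> sat A v \<phi> \<or> sat A v \<psi>"
| "sat A v (Imp \<phi> \<psi>) \<longleftrightarrow> (sat A v \<phi> \<longrightarrow> sat A v \<psi>)"
| "sat A v (All x \<phi>) \<longleftrightarrow> (\<forall>a \<in> dom A (snd x). sat A (v(x := a)) \<phi>)"
| "sat A v (Ex x \<phi>) \<longleftrightarrow> (\<exists>a \<in> dom A (snd x). sat A (v(x := a)) \<phi>)"

definition assignment ::
    "('s, 'f, 'p) signature \<Rightarrow> ('s, 'f, 'p, 'u) struct \<Rightarrow> ('s var \<Rightarrow> 'u) \<Rightarrow> bool" where
  "assignment \<Sigma> A v \<longleftrightarrow> (\<forall>n. \<forall>\<sigma> \<in> sorts \<Sigma>. v (n, \<sigma>) \<in> dom A \<sigma>)"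

definition satisfies ::
    "('s, 'f, 'p) signature \<Rightarrow> ('s, 'f, 'p, 'u) struct \<Rightarrow> ('s, 'f, 'p) form \<Rightarrow> bool" where
  "satisfies \<Sigma> A \<phi> \<longleftrightarrow> (\<forall>v. assignment \<Sigma> A v \<longrightarrow> sat A v \<phi>)"

definition is_model ::
    "('s, 'f, 'p) signature \<Rightarrow> ('s, 'f, 'p) form set \<Rightarrow> ('s, 'f, 'p, 'u) struct \<Rightarrow> bool" where
  "is_model \<Sigma> T A \<longleftrightarrow> is_structure \<Sigma> A \<and> (\<forall>\<phi> \<in> T. satisfies \<Sigma> A \<phi>)"

definition isomorphic ::
    "('s, 'f, 'p) signature \<Rightarrow> ('s, 'f, 'p, 'u) struct \<Rightarrow> ('s, 'f, 'p, 'w) struct \<Rightarrow> bool" where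
  "isomorphic \<Sigma> A B \<longleftrightarrow>
     (\<exists>h :: 's \<Rightarrow> 'u \<Rightarrow> 'w.
        (\<forall>\<sigma> \<in> sorts \<Sigma>. bij_betw (h \<sigma>) (dom A \<sigma>) (dom B \<sigma>)) \<and>
        (\<forall>f \<in> funs \<Sigma>. \<forall>as \<in> args A (fst (farity \<Sigma> f)).
           h (snd (farity \<Sigma> f)) (fint A f as) = fint B f (map2 h (fst (farity \<Sigma> f)) as)) \<and>
        (\<forall>p \<in> preds \<Sigma>. \<forall>as \<in> args A (parity \<Sigma> p).
           pint A p as \<longleftrightarrow> pint B p (map2 h (parity \<Sigma> p) as)))"

definition strongly_infinite ::
    "('s, 'f, 'p) signature \<Rightarrow> ('s, 'f, 'p, 'u) struct \<Rightarrow> bool" where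
  "strongly_infinite \<Sigma> A \<longleftrightarrow> (\<forall>\<sigma> \<in> sorts \<Sigma>. natLeq \<le>o |dom A \<sigma>| )"


section \<open>Properties of theories\<close>

text \<open>
  HOL cannot quantify over all types within a formula, so notions that quantify over all
  structures take the universe type as an argument. The type \<open>'k\<close> only carries the
  cardinals; it is unrelated to the universe.
\<close>

definition all_models_strongly_infinite ::
    "'u itself \<Rightarrow> ('s, 'f, 'p) signature \<Rightarrow> ('s, 'f, 'p) form set \<Rightarrow> bool" where
  "all_models_strongly_infinite (_ :: 'u itself) \<Sigma> T \<longleftrightarrow>
     (\<forall>A :: ('s, 'f, 'p, 'u) struct. is_model \<Sigma> T A \<longrightarrow> strongly_infinite \<Sigma> A)"

definition has_cards ::
    "('s, 'f, 'p) signature \<Rightarrow> ('s \<Rightarrow> 'k rel) \<Rightarrow> ('s, 'f, 'p, 'u) struct \<Rightarrow> bool" where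
  "has_cards \<Sigma> \<kappa> A \<longleftrightarrow> (\<forall>\<sigma> \<in> sorts \<Sigma>. |dom A \<sigma>| =o \<kappa> \<sigma>)"

definition categorical ::
    "'u itself \<Rightarrow> ('s, 'f, 'p) signature \<Rightarrow> ('s \<Rightarrow> 'k rel) \<Rightarrow> ('s, 'f, 'p) form set \<Rightarrow> bool" where
  "categorical (_ :: 'u itself) \<Sigma> \<kappa> T \<longleftrightarrow>
     (\<exists>A :: ('s, 'f, 'p, 'u) struct. is_model \<Sigma> T A \<and> has_cards \<Sigma> \<kappa> A) \<and>
     (\<forall>(A :: ('s, 'f, 'p, 'u) struct) (B :: ('s, 'f, 'p, 'u) struct).
        is_model \<Sigma> T A \<and> has_cards \<Sigma> \<kappa> A \<and> is_model \<Sigma> T B \<and> has_cards \<Sigma> \<kappa> B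
        \<longrightarrow> isomorphic \<Sigma> A B)"

definition entails ::
    "'u itself \<Rightarrow> ('s, 'f, 'p) signature \<Rightarrow> ('s, 'f, 'p) form set \<Rightarrow> ('s, 'f, 'p) form \<Rightarrow> bool" where
  "entails (_ :: 'u itself) \<Sigma> T \<phi> \<longleftrightarrow>
     (\<forall>A :: ('s, 'f, 'p, 'u) struct. is_model \<Sigma> T A \<longrightarrow> satisfies \<Sigma> A \<phi>)"

definition complete_theory ::
    "'u itself \<Rightarrow> ('s, 'f, 'p) signature \<Rightarrow> ('s, 'f, 'p) form set \<Rightarrow> bool" where
  "complete_theory U \<Sigma> T \<longleftrightarrow>
     (\<forall>\<phi>. sentence \<Sigma> \<phi> \<longrightarrow> entails U \<Sigma> T \<phi> \<or> entails U \<Sigma> T (Neg \<phi>))"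

end

theory Submission
  imports Defs
begin

text \<open>
  Two models of \<open>T\<close> that disagree on a sentence can be replaced by models of cardinalities \<open>\<kappa>\<close>
  with the same theories, which categoricity forbids. An ultrapower over the finite subsets of a
  large set makes every infinite sort large, and then each sort \<open>\<sigma>\<close> is cut down to \<open>\<kappa> \<sigma>\<close> by a
  Skolem hull with respect to the formulas of \<open>\<Sigma>\<^sub>\<sigma>\<close> alone, of which there are at most \<open>\<kappa> \<sigma>\<close>.
  These separate hulls form an elementary substructure because, \<open>\<Sigma>\<close> being completely split, the
  truth of any formula is determined by that of finitely many one-sorted formulas.

  The universe of the models in the conclusion may differ from the one in which the models are
  assumed to be infinite; the hulls also show that a model with a finite sort would be equivalent
  to one living in the latter universe.
\<close>

section \<open>Finitary closures\<close>

text \<open>The usual downward argument closes under Skolem functions for the whole language. In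
  sort \<sigma> these would be indexed by all formulas of \<Sigma> and take parameters from every
  sort, so the hull could grow to |\<Sigma>| or to some \<kappa> \<tau>, either of which may exceed
  \<kappa> \<sigma>. Hence the hulls are taken sort by sort, and it has to be shown that they fit
  together.

  Upward, an ultrapower replaces a compactness argument and enlarges all sorts at once, however many
  there are. It may overshoot, since the hull keeps a prescribed subset of size \<kappa> \<sigma>
  and grows no larger than that. A finite sort would keep its size in every ultrapower: this is
  where the infinite domains enter. They also make \<kappa> \<sigma> infinite, because some model
  has these cardinalities, and an infinite \<kappa> \<sigma> absorbs the countably many variables in
  the count of formulas.\<close>

lemma infinite_natLeq_card: "natLeq \<le>o |X| \<longleftrightarrow> infinite X"
  using infinite_iff_natLeq_ordLeq by blast

lemma card_of_Union_infinite:
  assumes "infinite K" "|I| \<le>o |K|" "\<And>i. i \<in> I \<Longrightarrow> |X i| \<le>o |K|"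
  shows "|\<Union>i\<in>I. X i| \<le>o |K|"
  using card_of_UNION_ordLeq_infinite[of K I X] assms by blast

lemma card_of_Un_infinite:
  assumes "infinite K" "|X| \<le>o |K|" "|Y| \<le>o |K|"
  shows "|X \<union> Y| \<le>o |K|"
  using card_of_Un_ordLeq_infinite_Field[of "|K|" X Y] assms
  by (simp add: Field_card_of card_of_card_order_on)

lemma card_of_insert_infinite:
  assumes "infinite K" "|X| \<le>o |K|"
  shows "|insert x X| \<le>o |K|"
proof -
  have "|{x}| \<le>o |K|" using assms(1) by (intro card_of_singl_ordLeq) auto
  from card_of_Un_infinite[OF assms(1) this assms(2)] show ?thesis by simp
qed

lemma card_of_subset_ordLeq: "X \<subseteq> Y \<Longrightarrow> |Y| \<le>o r \<Longrightarrow> |X| \<le>o r"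
  by (rule ordLeq_transitive[OF card_of_mono1])

lemma card_of_image_ordLeq: "|X| \<le>o r \<Longrightarrow> |f ` X| \<le>o r"
  by (rule ordLeq_transitive[OF card_of_image])

lemma card_of_nat_infinite:
  assumes "infinite K"
  shows "|N :: nat set| \<le>o |K|"
proof -
  obtain f :: "nat \<Rightarrow> 'a" where "inj f" "range f \<subseteq> K"
    using infinite_countable_subset[OF assms] by blast
  then show ?thesis by (intro card_of_ordLeqI[of f]) (auto intro: inj_on_subset)
qed

lemma card_of_Times_ordLeq:
  assumes "infinite K" "|X| \<le>o |K|" "|Y| \<le>o |K|"
  shows "|X \<times> Y| \<le>o |K|"
  using card_of_Times_ordLeq_infinite_Field[of "|K|" X Y] assms
  by (simp add: Field_card_of card_of_card_order_on)

lemma card_of_lists_ordLeq: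
  assumes K: "infinite K" and X: "|X| \<le>o |K|"
  shows "|lists X| \<le>o |K|"
proof -
  have "|{xs \<in> lists X. length xs = n}| \<le>o |K|" for n
  proof (induction n)
    case 0
    have "{xs \<in> lists X. length xs = 0} = {[]}" by auto
    then show ?case using K by (simp add: infinite_imp_nonempty card_of_singl_ordLeq)
  next
    case (Suc n)
    have "{xs \<in> lists X. length xs = Suc n}
        \<subseteq> (\<lambda>(x, xs). x # xs) ` (X \<times> {xs \<in> lists X. length xs = n})"
    proof
      fix xs assume "xs \<in> {xs \<in> lists X. length xs = Suc n}"
      then show "xs \<in> (\<lambda>(x, xs). x # xs) ` (X \<times> {xs \<in> lists X. length xs = n})"
        by (cases xs) auto
    qed
    moreover have "|(\<lambda>(x, xs). x # xs) ` (X \<times> {xs \<in> lists X. length xs = n})| \<le>o |K|"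
      by (intro card_of_image_ordLeq card_of_Times_ordLeq K X Suc)
    ultimately show ?case
      by (rule card_of_subset_ordLeq)
  qed
  then have "|\<Union>n. {xs \<in> lists X. length xs = n}| \<le>o |K|"
    by (intro card_of_Union_infinite K card_of_nat_infinite)
  moreover have "lists X = (\<Union>n. {xs \<in> lists X. length xs = n})"
    by auto
  ultimately show ?thesis by simp
qed

text \<open>Operations act on lists of every length, so that constants, term and formula
  constructors and Skolem functions share one format and one cardinality bound. A constant is an
  operation that ignores its list; applied to \<open>[]\<close> it starts the closure and takes the
  place of a base set.\<close>

inductive_set generated :: "('a list \<Rightarrow> 'a) set \<Rightarrow> 'a set" for ops where
  "g \<in> ops \<Longrightarrow> \<forall>x \<in> set xs. x \<in> generated ops \<Longrightarrow> g xs \<in> generated ops"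

lemma generated_const: "(\<lambda>_. a) \<in> ops \<Longrightarrow> a \<in> generated ops"
  using generated.intros[of "\<lambda>_. a" ops "[]"] by simp

text \<open>An argument list has finitely many entries, so it lies within one of countably many
  stages, and each stage adds only the values of \<open>ops\<close> on lists over the previous
  one.\<close>

lemma card_of_generated:
  assumes K: "infinite K" and ops: "|ops| \<le>o |K|"
  shows "|generated ops| \<le>o |K|"
proof -
  define L where "L = rec_nat {} (\<lambda>_ X. X \<union> (\<Union>g\<in>ops. g ` lists X))"
  have L0: "L 0 = {}" and LSuc: "L (Suc n) = L n \<union> (\<Union>g\<in>ops. g ` lists (L n))" for n
    by (simp_all add: L_def)
  have L_card: "|L n| \<le>o |K|" for n
  proof (induction n)
    case 0
    show ?case by (simp add: L0 card_of_empty)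
  next
    case (Suc n)
    then show ?case
      unfolding LSuc
      by (intro card_of_Un_infinite card_of_Union_infinite card_of_image_ordLeq
          card_of_lists_ordLeq K ops)
  qed
  have mono: "m \<le> n \<Longrightarrow> L m \<subseteq> L n" for m n
    by (rule lift_Suc_mono_le[of L]) (auto simp: LSuc)
  have "x \<in> (\<Union>n. L n)" if "x \<in> generated ops" for x
    using that
  proof induction
    case (1 g xs)
    then have "\<forall>x\<in>set xs. \<exists>n. x \<in> L n" by blast
    then obtain N where "\<forall>x\<in>set xs. x \<in> L (N x)" by metis
    \<comment> \<open>On the empty list \<open>Max\<close> is unspecified, but any stage will do
      there.\<close>
    then have "\<forall>x\<in>set xs. x \<in> L (Max (N ` set xs))"
      using mono by (meson List.finite_set Max_ge finite_imageI image_eqI subsetD)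
    then have "g xs \<in> L (Suc (Max (N ` set xs)))"
      using 1(1) by (auto simp: LSuc)
    then show ?case by blast
  qed
  then have "generated ops \<subseteq> (\<Union>n. L n)" by blast
  moreover have "|\<Union>n. L n| \<le>o |K|"
    by (intro card_of_Union_infinite K card_of_nat_infinite L_card)
  ultimately show ?thesis
    by (rule card_of_subset_ordLeq)
qed


section \<open>Ultrafilters\<close>

definition ultra :: "'i filter \<Rightarrow> bool" where
  "ultra F \<longleftrightarrow> F \<noteq> bot \<and> (\<forall>P. eventually P F \<or> eventually (\<lambda>i. \<not> P i) F)"

lemma ultra_not_iff:
  assumes "ultra F"
  shows "eventually (\<lambda>i. \<not> P i) F \<longleftrightarrow> \<not> eventually P F"
proof -
  have "\<not> (eventually (\<lambda>i. \<not> P i) F \<and> eventually P F)"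
    using assms eventually_conj[of "\<lambda>i. \<not> P i" F P] by (auto simp: ultra_def eventually_False)
  then show ?thesis using assms by (auto simp: ultra_def)
qed

lemma ultra_disj_iff:
  assumes "ultra F"
  shows "eventually (\<lambda>i. P i \<or> Q i) F \<longleftrightarrow> eventually P F \<or> eventually Q F"
  using ultra_not_iff[OF assms, of "\<lambda>i. \<not> P i \<and> \<not> Q i"]
  by (simp add: eventually_conj_iff ultra_not_iff[OF assms])

lemma ultra_imp_iff:
  assumes "ultra F"
  shows "eventually (\<lambda>i. P i \<longrightarrow> Q i) F \<longleftrightarrow> (eventually P F \<longrightarrow> eventually Q F)"
  unfolding imp_conv_disj ultra_disj_iff[OF assms] ultra_not_iff[OF assms] ..

text \<open>Finer filters are smaller in this order, so an ultrafilter is a minimal proper filter.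
  Zorn's lemma is applied to the reversed order, with infima bounding the chains.\<close>

lemma ultra_exists:
  fixes F :: "'i filter"
  assumes "F \<noteq> bot"
  obtains U where "U \<le> F" "ultra U"
proof -
  let ?A = "{G. G \<noteq> bot \<and> G \<le> F}"
  have "\<exists>m\<in>?A. \<forall>a\<in>?A. a \<le> m \<longrightarrow> a = m"
  proof (rule predicate_Zorn[of ?A "\<lambda>G H. H \<le> G"])
    show "partial_order_on ?A (relation_of (\<lambda>G H. H \<le> G) ?A)"
      by (rule partial_order_on_relation_ofI) auto
    fix C assume C: "C \<in> Chains (relation_of (\<lambda>G H. H \<le> G) ?A)"
    show "\<exists>u\<in>?A. \<forall>a\<in>C. u \<le> a"
    proof (cases "C = {}")
      case True
      then show ?thesis using assms by auto
    next
      case False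
      have sub: "C \<subseteq> ?A" using C by (auto simp: Chains_def relation_of_def)
      \<comment> \<open>A chain is directed downwards, so what holds eventually in
        \<open>Inf C\<close> already holds eventually in some member; hence \<open>Inf C\<close> is
        proper.\<close>
      have "\<exists>x\<in>C. x \<le> inf G H" if "G \<in> C" "H \<in> C" for G H
      proof -
        have "G \<le> H \<or> H \<le> G"
          using C that by (auto simp: Chains_def relation_of_def)
        then show ?thesis using that by (metis inf.absorb1 inf.absorb2 order_refl)
      qed
      then have "eventually (\<lambda>_. False) (Inf C) \<longleftrightarrow> (\<exists>G\<in>C. eventually (\<lambda>_. False) G)"
        using False by (intro eventually_Inf_base)
      then have "Inf C \<noteq> bot"
        using sub by (auto simp: eventually_False)
      moreover have "Inf C \<le> F"
        using False sub by (auto intro: Inf_lower2)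
      ultimately show ?thesis by (auto intro: Inf_lower)
    qed
  qed
  then obtain U where U: "U \<noteq> bot" "U \<le> F"
    and max: "\<And>G. G \<noteq> bot \<Longrightarrow> G \<le> U \<Longrightarrow> G = U"
    by (auto intro: order_trans)
  have "eventually P U \<or> eventually (\<lambda>i. \<not> P i) U" for P
  proof (rule disjCI)
    assume "\<not> eventually (\<lambda>i. \<not> P i) U"
    \<comment> \<open>Adding \<open>P\<close> keeps the filter proper because the negation of
      \<open>P\<close> is not in \<open>U\<close>; by minimality nothing was added.\<close>
    then have "inf U (principal {i. P i}) \<noteq> bot"
      by (simp add: trivial_limit_def eventually_inf_principal)
    then have "inf U (principal {i. P i}) = U" by (intro max) auto
    moreover have "eventually P (inf U (principal {i. P i}))"
      by (simp add: eventually_inf_principal)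
    ultimately show "eventually P U" by simp
  qed
  then show ?thesis using U that by (auto simp: ultra_def)
qed


section \<open>Satisfaction and ultrapowers\<close>

lemma eval_cong: "(\<And>x. x \<in> fv_trm t \<Longrightarrow> v x = w x) \<Longrightarrow> eval A v t = eval A w t"
proof (induction t)
  case (Fn f ts)
  have "eval A v t = eval A w t" if "t \<in> set ts" for t
    by (rule Fn.IH[OF that]) (use Fn.prems that in auto)
  then have "map (eval A v) ts = map (eval A w) ts" by simp
  then show ?case by (simp only: eval.simps)
qed simp

lemma sat_cong: "(\<And>x. x \<in> fv \<phi> \<Longrightarrow> v x = w x) \<Longrightarrow> sat A v \<phi> \<longleftrightarrow> sat A w \<phi>"
proof (induction \<phi> arbitrary: v w)
  case (Rel p ts)
  then have "eval A v t = eval A w t" if "t \<in> set ts" for t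
    using that by (intro eval_cong) auto
  then have "map (eval A v) ts = map (eval A w) ts" by simp
  then show ?case by (simp only: sat.simps)
next
  case (Neg \<phi>)
  from Neg.IH[of v w] Neg.prems show ?case by simp
next
  case (Conj \<phi> \<psi>)
  from Conj.IH(1)[of v w] Conj.IH(2)[of v w] Conj.prems show ?case by simp
next
  case (Disj \<phi> \<psi>)
  from Disj.IH(1)[of v w] Disj.IH(2)[of v w] Disj.prems show ?case by simp
next
  case (Imp \<phi> \<psi>)
  from Imp.IH(1)[of v w] Imp.IH(2)[of v w] Imp.prems show ?case by simp
next
  case (All x \<phi>)
  have "sat A (v(x := a)) \<phi> = sat A (w(x := a)) \<phi>" for a
    by (rule All.IH) (use All.prems in auto)
  then show ?case by simp
next
  case (Ex x \<phi>)
  have "sat A (v(x := a)) \<phi> = sat A (w(x := a)) \<phi>" for a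
    by (rule Ex.IH) (use Ex.prems in auto)
  then show ?case by simp
qed

text \<open>Nonempty domains supply an assignment, so \<open>satisfies\<close> is not vacuous, and a
  sentence does not see the valuation. Therefore \<open>v\<close> may be arbitrary, even with values
  outside the domains, and later uses need not check that it is an assignment.\<close>

lemma satisfies_sentence:
  assumes "is_structure \<Sigma> A" "sentence \<Sigma> \<phi>"
  shows "satisfies \<Sigma> A \<phi> \<longleftrightarrow> sat A v \<phi>"
proof -
  define w where "w = (\<lambda>x :: 'a var. SOME a. a \<in> dom A (snd x))"
  have "assignment \<Sigma> A w"
    using assms(1) by (auto simp: assignment_def w_def is_structure_def some_in_eq)
  moreover have "sat A u \<phi> \<longleftrightarrow> sat A v \<phi>" for u
    using assms(2) by (intro sat_cong) (auto simp: sentence_def)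
  ultimately show ?thesis
    by (auto simp: satisfies_def)
qed

lemma satisfies_Neg_sentence:
  assumes "is_structure \<Sigma> A" "sentence \<Sigma> \<phi>"
  shows "satisfies \<Sigma> A (Neg \<phi>) \<longleftrightarrow> \<not> satisfies \<Sigma> A \<phi>"
proof -
  have "sentence \<Sigma> (Neg \<phi>)" using assms(2) by (simp add: sentence_def)
  then show ?thesis
    using satisfies_sentence[OF assms(1)] assms(2) by (metis sat.simps(2))
qed

section \<open>Ultrapowers and the theorem of Los\<close>

definition eq_class :: "'i filter \<Rightarrow> ('i \<Rightarrow> 'a) \<Rightarrow> ('i \<Rightarrow> 'a) set" where
  "eq_class F f = {g. eventually (\<lambda>i. f i = g i) F}"

text \<open>With chosen representatives the ultrapower can be defined before well-definedness is
  shown; independence of the choice is the content of \<open>fint_ultrapower\<close> and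
  \<open>pint_ultrapower\<close>.\<close>

definition class_rep :: "('i \<Rightarrow> 'a) set \<Rightarrow> 'i \<Rightarrow> 'a" where
  "class_rep c = (SOME f. f \<in> c)"

lemma eq_class_eq_iff: "eq_class F f = eq_class F g \<longleftrightarrow> eventually (\<lambda>i. f i = g i) F"
proof
  assume eq: "eq_class F f = eq_class F g"
  have "g \<in> eq_class F f" unfolding eq by (simp add: eq_class_def)
  then show "eventually (\<lambda>i. f i = g i) F" by (simp add: eq_class_def)
next
  assume "eventually (\<lambda>i. f i = g i) F"
  then show "eq_class F f = eq_class F g"
    by (auto simp: eq_class_def elim: eventually_elim2)
qed

lemma class_rep_eq_class: "eventually (\<lambda>i. class_rep (eq_class F f) i = f i) F"
proof -
  have "f \<in> eq_class F f" by (simp add: eq_class_def)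
  then have "class_rep (eq_class F f) \<in> eq_class F f"
    unfolding class_rep_def by (rule someI[of "\<lambda>g. g \<in> eq_class F f"])
  then show ?thesis by (simp add: eq_class_def eq_commute)
qed

lemma class_rep_eq_class_list:
  "eventually (\<lambda>i. map (\<lambda>c. class_rep c i) (map (eq_class F) fs) = map (\<lambda>f. f i) fs) F"
proof (induction fs)
  case (Cons f fs)
  then show ?case
    using class_rep_eq_class[of F f] by eventually_elim simp
qed simp

text \<open>All sorts share one quotient of all functions, so overlapping domains need no separate
  treatment. Since membership in a domain is only asked almost everywhere, a function never has to
  be corrected at negligible indices.\<close>

definition ultrapower ::
    "'i filter \<Rightarrow> ('s, 'f, 'p, 'a) struct \<Rightarrow> ('s, 'f, 'p, ('i \<Rightarrow> 'a) set) struct" where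
  "ultrapower F A =
     \<lparr>dom = \<lambda>\<sigma>. eq_class F ` {f. eventually (\<lambda>i. f i \<in> dom A \<sigma>) F},
      fint = \<lambda>g cs. eq_class F (\<lambda>i. fint A g (map (\<lambda>c. class_rep c i) cs)),
      pint = \<lambda>p cs. eventually (\<lambda>i. pint A p (map (\<lambda>c. class_rep c i) cs)) F\<rparr>"

lemma fint_ultrapower:
  "fint (ultrapower F A) g (map (eq_class F) fs) = eq_class F (\<lambda>i. fint A g (map (\<lambda>f. f i) fs))"
  unfolding ultrapower_def struct.simps eq_class_eq_iff
  using class_rep_eq_class_list[of F fs] by eventually_elim (simp only:)

lemma pint_ultrapower:
  "pint (ultrapower F A) p (map (eq_class F) fs) \<longleftrightarrow>
     eventually (\<lambda>i. pint A p (map (\<lambda>f. f i) fs)) F"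
  unfolding ultrapower_def struct.simps
proof (rule eventually_cong[OF class_rep_eq_class_list])
  fix i assume "map (\<lambda>c. class_rep c i) (map (eq_class F) fs) = map (\<lambda>f. f i) fs"
  then show "pint A p (map (\<lambda>c. class_rep c i) (map (eq_class F) fs)) = pint A p (map (\<lambda>f. f i) fs)"
    by (simp only:)
qed

lemma eval_ultrapower:
  "eval (ultrapower F A) (\<lambda>x. eq_class F (v x)) t = eq_class F (\<lambda>i. eval A (\<lambda>x. v x i) t)"
proof (induction t)
  case (Fn f ts)
  have "map (eval (ultrapower F A) (\<lambda>x. eq_class F (v x))) ts
      = map (eq_class F) (map (\<lambda>t i. eval A (\<lambda>x. v x i) t) ts)"
    using Fn by simp
  then have "eval (ultrapower F A) (\<lambda>x. eq_class F (v x)) (Fn f ts)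
      = eq_class F (\<lambda>i. fint A f (map (\<lambda>f. f i) (map (\<lambda>t i. eval A (\<lambda>x. v x i) t) ts)))"
    by (simp only: eval.simps fint_ultrapower)
  then show ?case by (simp add: o_def)
qed simp

text \<open>The valuation is given by functions instead of classes, so an updated valuation has the
  same form and the induction hypothesis applies to it. Negation uses the ultrafilter property, and
  a universal quantifier is treated as a negated existential one.\<close>

theorem Los:
  assumes "ultra F"
  shows "sat (ultrapower F A) (\<lambda>x. eq_class F (v x)) \<phi> \<longleftrightarrow>
    eventually (\<lambda>i. sat A (\<lambda>x. v x i) \<phi>) F"
proof -
  let ?U = "ultrapower F A"
  have ex: "(\<exists>c \<in> dom ?U \<sigma>. sat ?U ((\<lambda>y. eq_class F (v y))(x := c)) \<psi>) \<longleftrightarrow>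
      eventually (\<lambda>i. \<exists>a \<in> dom A \<sigma>. sat A ((\<lambda>y. v y i)(x := a)) \<psi>) F"
    if IH: "\<And>v. sat ?U (\<lambda>x. eq_class F (v x)) \<psi> \<longleftrightarrow>
      eventually (\<lambda>i. sat A (\<lambda>x. v x i) \<psi>) F" for \<psi> v x \<sigma>
  proof -
    have upd: "sat ?U ((\<lambda>y. eq_class F (v y))(x := eq_class F f)) \<psi> \<longleftrightarrow>
        eventually (\<lambda>i. sat A ((\<lambda>y. v y i)(x := f i)) \<psi>) F" for f
    proof -
      have "(\<lambda>y. eq_class F (v y))(x := eq_class F f) = (\<lambda>y. eq_class F ((v(x := f)) y))"
        "\<And>i. (\<lambda>y. v y i)(x := f i) = (\<lambda>y. (v(x := f)) y i)" by (auto simp: fun_eq_iff)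
      then show ?thesis using IH[of "v(x := f)"] by simp
    qed
    have "(\<exists>c \<in> dom ?U \<sigma>. sat ?U ((\<lambda>y. eq_class F (v y))(x := c)) \<psi>) \<longleftrightarrow>
        (\<exists>f. eventually (\<lambda>i. f i \<in> dom A \<sigma> \<and> sat A ((\<lambda>y. v y i)(x := f i)) \<psi>) F)"
      by (auto simp: ultrapower_def upd[unfolded ultrapower_def] eventually_conj_iff)
    also have "\<dots> \<longleftrightarrow> eventually (\<lambda>i. \<exists>a. a \<in> dom A \<sigma> \<and> sat A ((\<lambda>y. v y i)(x := a)) \<psi>) F"
    proof
      assume "\<exists>f. eventually (\<lambda>i. f i \<in> dom A \<sigma> \<and> sat A ((\<lambda>y. v y i)(x := f i)) \<psi>) F"
      then obtain f where "eventually (\<lambda>i. f i \<in> dom A \<sigma> \<and> sat A ((\<lambda>y. v y i)(x := f i)) \<psi>) F" ..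
      then show "eventually (\<lambda>i. \<exists>a. a \<in> dom A \<sigma> \<and> sat A ((\<lambda>y. v y i)(x := a)) \<psi>) F"
        by eventually_elim blast
    next
      let ?P = "\<lambda>i a. a \<in> dom A \<sigma> \<and> sat A ((\<lambda>y. v y i)(x := a)) \<psi>"
      assume "eventually (\<lambda>i. \<exists>a. ?P i a) F"
      \<comment> \<open>Witnesses chosen index by index form one function; its values at the
        negligible indices without a witness do not matter.\<close>
      then have "eventually (\<lambda>i. ?P i (SOME a. ?P i a)) F"
        by (rule eventually_mono) (rule someI_ex)
      then show "\<exists>f. eventually (\<lambda>i. ?P i (f i)) F"
        by (intro exI[of _ "\<lambda>i. SOME a. ?P i a"])
    qed
    finally show ?thesis by (simp only: Bex_def)
  qed
  have not: "eventually (\<lambda>i. \<not> P i) F \<longleftrightarrow> \<not> eventually P F" for P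
    by (rule ultra_not_iff[OF assms])
  show ?thesis
  proof (induction \<phi> arbitrary: v)
    case (Rel p ts)
    have "map (eval ?U (\<lambda>x. eq_class F (v x))) ts
        = map (eq_class F) (map (\<lambda>t i. eval A (\<lambda>x. v x i) t) ts)"
      by (simp add: eval_ultrapower)
    then have "sat ?U (\<lambda>x. eq_class F (v x)) (Rel p ts) \<longleftrightarrow>
        eventually (\<lambda>i. pint A p (map (\<lambda>f. f i) (map (\<lambda>t i. eval A (\<lambda>x. v x i) t) ts))) F"
      by (simp only: sat.simps pint_ultrapower)
    then show ?case by (simp add: o_def)
  next
    case (All x \<phi>)
    have "sat ?U (\<lambda>x. eq_class F (v x)) (All x \<phi>) \<longleftrightarrow>
        \<not> (\<exists>c \<in> dom ?U (snd x). sat ?U ((\<lambda>y. eq_class F (v y))(x := c)) (Neg \<phi>))" by simp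
    also have "\<dots> \<longleftrightarrow> \<not> eventually (\<lambda>i. \<exists>a \<in> dom A (snd x). sat A ((\<lambda>y. v y i)(x := a)) (Neg \<phi>)) F"
      by (subst ex) (simp_all add: All.IH not)
    also have "\<dots> \<longleftrightarrow> eventually (\<lambda>i. sat A (\<lambda>y. v y i) (All x \<phi>)) F"
      by (simp flip: not)
    finally show ?case .
  next
    case (Ex x \<phi>)
    show ?case using ex[OF Ex.IH] by simp
  qed (simp_all add: not eventually_conj_iff ultra_disj_iff[OF assms] ultra_imp_iff[OF assms])
qed

lemma is_structure_ultrapower:
  assumes A: "is_structure \<Sigma> A" and "F \<noteq> bot"
    and arity: "\<And>\<sigma>. \<sigma> \<in> sorts \<Sigma> \<Longrightarrow> parity \<Sigma> (eqsym \<Sigma> \<sigma>) = [\<sigma>, \<sigma>]"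
  shows "is_structure \<Sigma> (ultrapower F A)"
  unfolding is_structure_def
proof (intro conjI ballI)
  fix \<sigma> assume "\<sigma> \<in> sorts \<Sigma>"
  then have "dom A \<sigma> \<noteq> {}" using A by (simp add: is_structure_def)
  then obtain a where "a \<in> dom A \<sigma>" by blast
  then have "eq_class F (\<lambda>_. a) \<in> dom (ultrapower F A) \<sigma>"
    by (auto simp: ultrapower_def)
  then show "dom (ultrapower F A) \<sigma> \<noteq> {}" by blast
next
  fix f cs
  assume f: "f \<in> funs \<Sigma>" and cs: "cs \<in> args (ultrapower F A) (fst (farity \<Sigma> f))"
  \<comment> \<open>There are finitely many arguments, so at almost all indices their
    representatives lie in the domains simultaneously.\<close>
  have "\<exists>fs. cs = map (eq_class F) fs \<and>
      eventually (\<lambda>i. map (\<lambda>f. f i) fs \<in> args A \<sigma>s) F"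
    if "cs \<in> args (ultrapower F A) \<sigma>s" for cs \<sigma>s
    using that unfolding args_def mem_Collect_eq
  proof (induction cs \<sigma>s rule: list_all2_induct)
    case Nil
    show ?case by (intro exI[of _ "[]"]) simp
  next
    case (Cons c cs \<sigma> \<sigma>s)
    then obtain fs f where "cs = map (eq_class F) fs" "c = eq_class F f"
      "eventually (\<lambda>i. list_all2 (\<lambda>a \<sigma>. a \<in> dom A \<sigma>) (map (\<lambda>f. f i) fs) \<sigma>s) F"
      "eventually (\<lambda>i. f i \<in> dom A \<sigma>) F"
      by (auto simp: ultrapower_def)
    then show ?case
      by (intro exI[of _ "f # fs"]) (auto simp: eventually_conj_iff)
  qed
  then obtain fs where fs: "cs = map (eq_class F) fs"
    "eventually (\<lambda>i. map (\<lambda>f. f i) fs \<in> args A (fst (farity \<Sigma> f))) F"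
    using cs by blast
  have "eventually (\<lambda>i. fint A f (map (\<lambda>f. f i) fs) \<in> dom A (snd (farity \<Sigma> f))) F"
    using fs(2) by eventually_elim (use A f in \<open>auto simp: is_structure_def\<close>)
  then show "fint (ultrapower F A) f cs \<in> dom (ultrapower F A) (snd (farity \<Sigma> f))"
    unfolding fs(1) fint_ultrapower by (auto simp: ultrapower_def)
next
  fix \<sigma> c d
  assume \<sigma>: "\<sigma> \<in> sorts \<Sigma>" and "c \<in> dom (ultrapower F A) \<sigma>" "d \<in> dom (ultrapower F A) \<sigma>"
  then obtain f g where fg: "c = eq_class F f" "d = eq_class F g"
    "eventually (\<lambda>i. f i \<in> dom A \<sigma>) F" "eventually (\<lambda>i. g i \<in> dom A \<sigma>) F"
    by (auto simp: ultrapower_def)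
  have "pint (ultrapower F A) (eqsym \<Sigma> \<sigma>) [c, d]
      \<longleftrightarrow> eventually (\<lambda>i. pint A (eqsym \<Sigma> \<sigma>) [f i, g i]) F"
    using pint_ultrapower[of F A _ "[f, g]"] fg by simp
  also have "\<dots> \<longleftrightarrow> eventually (\<lambda>i. f i = g i) F"
  proof (rule eventually_cong[OF eventually_conj[OF fg(3,4)]])
    show "pint A (eqsym \<Sigma> \<sigma>) [f i, g i] \<longleftrightarrow> f i = g i" if "f i \<in> dom A \<sigma> \<and> g i \<in> dom A \<sigma>" for i
      using A \<sigma> that by (auto simp: is_structure_def)
  qed
  also have "\<dots> \<longleftrightarrow> c = d"
    by (simp add: fg eq_class_eq_iff)
  finally show "pint (ultrapower F A) (eqsym \<Sigma> \<sigma>) [c, d] \<longleftrightarrow> c = d" .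
qed

lemma satisfies_ultrapower:
  fixes F :: "'i filter" and A :: "('s, 'f, 'p, 'a) struct"
  assumes "is_structure \<Sigma> A" "is_structure \<Sigma> (ultrapower F A)" "ultra F" "sentence \<Sigma> \<phi>"
  shows "satisfies \<Sigma> (ultrapower F A) \<phi> \<longleftrightarrow> satisfies \<Sigma> A \<phi>"
proof -
  \<comment> \<open>A sentence ignores the valuation, so meaningless values suffice.\<close>
  define v where "v = (\<lambda>(x :: 's var) (i :: 'i). undefined :: 'a)"
  have "satisfies \<Sigma> (ultrapower F A) \<phi> \<longleftrightarrow> sat (ultrapower F A) (\<lambda>x. eq_class F (v x)) \<phi>"
    by (rule satisfies_sentence[OF assms(2,4)])
  also have "\<dots> \<longleftrightarrow> eventually (\<lambda>i. sat A (\<lambda>x. v x i) \<phi>) F"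
    by (rule Los[OF assms(3)])
  also have "\<dots> \<longleftrightarrow> eventually (\<lambda>_. satisfies \<Sigma> A \<phi>) F"
    using satisfies_sentence[OF assms(1,4)] by simp
  also have "\<dots> \<longleftrightarrow> satisfies \<Sigma> A \<phi>"
    using assms(3) by (simp add: ultra_def eventually_const_iff)
  finally show ?thesis .
qed

text \<open>
  Regular ultrapower: over the finite subsets of the index type, the classes of
  \<open>i \<mapsto> e i k\<close>, with \<open>e i\<close> injective on \<open>i\<close>, are distinct for distinct \<open>k\<close>.
\<close>

lemma inj_into_ultrapower:
  fixes F :: "'k set filter" and A :: "('s, 'f, 'p, 'd) struct"
  assumes F: "F \<le> finite_subsets_at_top UNIV" "F \<noteq> bot" and inf: "infinite (dom A \<sigma>)"
  obtains h :: "'k \<Rightarrow> _" where "inj h" "range h \<subseteq> dom (ultrapower F A) \<sigma>"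
proof -
  \<comment> \<open>Infinite \<open>i\<close> are negligible in \<open>F\<close>, so nothing is
    asked of them. At a finite \<open>i\<close>, arguments outside \<open>i\<close> go to a fixed
    element, which keeps the whole range in the domain.\<close>
  have "\<exists>e :: 'k \<Rightarrow> 'd. finite i \<longrightarrow> inj_on e i \<and> range e \<subseteq> dom A \<sigma>" for i
  proof (cases "finite i")
    case True
    obtain X where X: "X \<subseteq> dom A \<sigma>" "finite X" "card X = card i"
      using infinite_arbitrarily_large[OF inf] by blast
    then obtain e where e: "bij_betw e i X"
      using True finite_same_card_bij by metis
    obtain a where "a \<in> dom A \<sigma>" using inf by fastforce
    with e X(1) have "inj_on (\<lambda>k. if k \<in> i then e k else a) i
        \<and> range (\<lambda>k. if k \<in> i then e k else a) \<subseteq> dom A \<sigma>"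
      by (auto simp: bij_betw_def inj_on_def)
    then show ?thesis by blast
  qed auto
  then obtain e :: "'k set \<Rightarrow> 'k \<Rightarrow> 'd"
    where e: "\<And>i. finite i \<Longrightarrow> inj_on (e i) i \<and> range (e i) \<subseteq> dom A \<sigma>" by metis
  have ev: "eventually (\<lambda>i. finite i \<and> k \<in> i \<and> l \<in> i) F" for k l
    by (rule filter_leD[OF F(1)])
      (auto simp: eventually_finite_subsets_at_top intro!: exI[of _ "{k, l}"])
  define h where "h = (\<lambda>k. eq_class F (\<lambda>i. e i k))"
  have "k = l" if "h k = h l" for k l
  proof -
    have "eventually (\<lambda>i. e i k = e i l) F" using that by (simp add: h_def eq_class_eq_iff)
    with ev[of k l] have "eventually (\<lambda>i. k = l) F"
      by eventually_elim (use e in \<open>auto dest: inj_onD\<close>)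
    then show ?thesis using F(2) by (simp add: eventually_const_iff)
  qed
  then have "inj h" by (auto simp: inj_def)
  moreover have "h k \<in> dom (ultrapower F A) \<sigma>" for k
  proof -
    have "eventually (\<lambda>i. e i k \<in> dom A \<sigma>) F"
      using ev[of k k] by eventually_elim (use e in auto)
    then show ?thesis by (auto simp: ultrapower_def h_def)
  qed
  ultimately show ?thesis using that by blast
qed


section \<open>Skolem hulls\<close>

lemma fv_trm_sorts: "has_sort \<Sigma> t \<tau> \<Longrightarrow> x \<in> fv_trm t \<Longrightarrow> snd x \<in> sorts \<Sigma>"
  by (induction rule: has_sort.induct) (auto simp: list_all2_conv_all_nth in_set_conv_nth)

lemma fv_sorts: "wf_form \<Sigma> \<phi> \<Longrightarrow> x \<in> fv \<phi> \<Longrightarrow> snd x \<in> sorts \<Sigma>"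
proof (induction \<phi>)
  case (Rel p ts)
  then obtain t where "t \<in> set ts" "x \<in> fv_trm t" by auto
  moreover have "\<exists>\<tau>. has_sort \<Sigma> t \<tau>"
    using Rel(1) \<open>t \<in> set ts\<close> by (auto simp: list_all2_conv_all_nth in_set_conv_nth)
  ultimately show ?case using fv_trm_sorts by metis
qed auto

lemma finite_fv_trm: "finite (fv_trm t)"
  by (induction t) auto

lemma finite_fv: "finite (fv \<phi>)"
  by (induction \<phi>) (auto simp: finite_fv_trm)

text \<open>The single sort leaves only countably many variables, which the infinite
  \<open>K\<close> absorbs; with many sorts the variables alone could outnumber
  \<open>K\<close>.\<close>

lemma card_of_terms:
  fixes S :: "('s, 'f, 'p) signature"
  assumes K: "infinite K" and S: "sorts S = {\<sigma>}" "|funs S| \<le>o |K|"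
  shows "|{t. \<exists>\<tau>. has_sort S t \<tau>}| \<le>o |K|"
proof -
  define ops where "ops = range (\<lambda>n (_ :: ('s, 'f) trm list). Var (n, \<sigma>)) \<union> Fn ` funs S"
  have "t \<in> generated ops" if "has_sort S t \<tau>" for t \<tau>
    using that
  proof (induction rule: has_sort.induct)
    case (Var \<tau> n)
    then show ?case using S by (intro generated_const) (auto simp: ops_def)
  next
    case (Fn f \<sigma>s \<tau> ts)
    have "Fn f \<in> ops" using Fn(1) by (auto simp: ops_def)
    moreover have "\<forall>t\<in>set ts. t \<in> generated ops"
      using Fn(3) by (auto simp: list_all2_conv_all_nth in_set_conv_nth)
    ultimately show ?case by (rule generated.intros)
  qed
  then have "{t. \<exists>\<tau>. has_sort S t \<tau>} \<subseteq> generated ops" by blast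
  moreover have "|ops| \<le>o |K|"
    unfolding ops_def
    by (intro card_of_Un_infinite card_of_image_ordLeq card_of_nat_infinite K S)
  ultimately show ?thesis
    using card_of_generated[OF K] card_of_subset_ordLeq by blast
qed

lemma card_of_formulas:
  fixes S :: "('s, 'f, 'p) signature"
  assumes K: "infinite K" and S: "sorts S = {\<sigma>}" "|funs S| \<le>o |K|" "|preds S| \<le>o |K|"
  shows "|{\<phi>. wf_form S \<phi>}| \<le>o |K|"
proof -
  \<comment> \<open>Atoms enter as constants; connectives and quantifiers read positions 0 and 1. On
    shorter lists \<open>!\<close> gives arbitrary formulas, which is harmless because only an upper
    bound is wanted.\<close>
  define ops :: "(('s, 'f, 'p) form list \<Rightarrow> ('s, 'f, 'p) form) set" where
    "ops = (\<lambda>(p, ts) _. Rel p ts) ` (preds S \<times> lists {t. \<exists>\<tau>. has_sort S t \<tau>})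
      \<union> {\<lambda>\<phi>s. Neg (\<phi>s ! 0), \<lambda>\<phi>s. Conj (\<phi>s ! 0) (\<phi>s ! 1), \<lambda>\<phi>s. Disj (\<phi>s ! 0) (\<phi>s ! 1),
          \<lambda>\<phi>s. Imp (\<phi>s ! 0) (\<phi>s ! 1)}
      \<union> range (\<lambda>n \<phi>s. All (n, \<sigma>) (\<phi>s ! 0)) \<union> range (\<lambda>n \<phi>s. Ex (n, \<sigma>) (\<phi>s ! 0))"
  have unary: "h [\<phi>] \<in> generated ops" if "h \<in> ops" "\<phi> \<in> generated ops" for h \<phi>
    using that by (intro generated.intros) auto
  have binary: "h [\<phi>, \<psi>] \<in> generated ops"
    if "h \<in> ops" "\<phi> \<in> generated ops" "\<psi> \<in> generated ops" for h \<phi> \<psi>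
    using that by (intro generated.intros) auto
  have "wf_form S \<phi> \<Longrightarrow> \<phi> \<in> generated ops" for \<phi>
  proof (induction \<phi>)
    case (Rel p ts)
    then have "\<forall>t \<in> set ts. \<exists>\<tau>. has_sort S t \<tau>"
      by (fastforce simp: list_all2_conv_all_nth in_set_conv_nth)
    then have "(\<lambda>_. Rel p ts) \<in> ops"
      using Rel by (auto simp: ops_def intro!: image_eqI[of _ _ "(p, ts)"])
    then show ?case by (rule generated_const)
  next
    case (Neg \<phi>)
    then show ?case using unary[of "\<lambda>\<phi>s. Neg (\<phi>s ! 0)" \<phi>] by (simp add: ops_def)
  next
    case (Conj \<phi> \<psi>)
    then show ?case using binary[of "\<lambda>\<phi>s. Conj (\<phi>s ! 0) (\<phi>s ! 1)" \<phi> \<psi>] by (simp add: ops_def)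
  next
    case (Disj \<phi> \<psi>)
    then show ?case using binary[of "\<lambda>\<phi>s. Disj (\<phi>s ! 0) (\<phi>s ! 1)" \<phi> \<psi>] by (simp add: ops_def)
  next
    case (Imp \<phi> \<psi>)
    then show ?case using binary[of "\<lambda>\<phi>s. Imp (\<phi>s ! 0) (\<phi>s ! 1)" \<phi> \<psi>] by (simp add: ops_def)
  next
    case (All x \<phi>)
    then obtain n where x: "x = (n, \<sigma>)" using S by (cases x) auto
    have "(\<lambda>\<phi>s. All (n, \<sigma>) (\<phi>s ! 0)) \<in> ops" by (auto simp: ops_def)
    from unary[OF this, of \<phi>] show ?case using All x by simp
  next
    case (Ex x \<phi>)
    then obtain n where x: "x = (n, \<sigma>)" using S by (cases x) auto
    have "(\<lambda>\<phi>s. Ex (n, \<sigma>) (\<phi>s ! 0)) \<in> ops" by (auto simp: ops_def)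
    from unary[OF this, of \<phi>] show ?case using Ex x by simp
  qed
  then have "{\<phi>. wf_form S \<phi>} \<subseteq> generated ops" by blast
  moreover have "|ops| \<le>o |K|"
    unfolding ops_def
    by (intro card_of_Un_infinite card_of_insert_infinite card_of_image_ordLeq card_of_nat_infinite
        card_of_Times_ordLeq card_of_lists_ordLeq card_of_terms[OF _ S(1)] card_of_empty K S)
  ultimately show ?thesis
    using card_of_generated[OF K] card_of_subset_ordLeq by blast
qed

lemma sig_card_bounds:
  assumes "sig_card S \<le>o |K|"
  shows "|funs S| \<le>o |K|" "|preds S| \<le>o |K|"
proof -
  have "|funs S <+> preds S| \<le>o |K|"
    using assms ordLeq_transitive[OF card_of_Plus2]
    by (simp add: sig_card_def csum_def Field_card_of)
  then show "|funs S| \<le>o |K|" "|preds S| \<le>o |K|"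
    using ordLeq_transitive[OF card_of_Plus1] ordLeq_transitive[OF card_of_Plus2] by blast+
qed

text \<open>The last conclusion is the Tarski-Vaught criterion for the formulas of \<open>S\<close>,
  obtained from one Skolem function per formula and variable name. The valuation is constrained only
  at sort \<sigma>, which is all that a formula of \<open>S\<close> can see; this lets the hulls of
  different sorts be built independently.\<close>

lemma skolem_hull:
  fixes A :: "('s, 'f, 'p, 'a) struct"
  assumes S: "wf_signature S" "sorts S = {\<sigma>}" and card: "sig_card S \<le>o |K|"
    and K: "infinite K" and D0: "D0 \<subseteq> dom A \<sigma>" "D0 \<noteq> {}" "|D0| \<le>o |K|"
    and A: "\<And>f as. f \<in> funs S \<Longrightarrow> as \<in> args A (fst (farity S f)) \<Longrightarrow> fint A f as \<in> dom A \<sigma>"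
  obtains D where "D0 \<subseteq> D" "D \<subseteq> dom A \<sigma>" "|D| \<le>o |K|"
    "\<And>f as. f \<in> funs S \<Longrightarrow> as \<in> args A (fst (farity S f)) \<Longrightarrow> set as \<subseteq> D \<Longrightarrow> fint A f as \<in> D"
    "\<And>\<psi> v n. wf_form S \<psi> \<Longrightarrow> \<forall>k. v (k, \<sigma>) \<in> D \<Longrightarrow> \<exists>a\<in>dom A \<sigma>. sat A (v((n, \<sigma>) := a)) \<psi> \<Longrightarrow>
       \<exists>a\<in>D. sat A (v((n, \<sigma>) := a)) \<psi>"
proof -
  obtain d0 where d0: "d0 \<in> D0" using D0 by blast
  \<comment> \<open>A list of elements serves as a valuation: entry \<open>k\<close> is the value of
    the variable named \<open>k\<close>, whose sort can only be \<sigma>.\<close>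
  define good where "good = (\<lambda>\<psi> n as a.
    a \<in> dom A \<sigma> \<and> sat A ((\<lambda>x :: 's var. as ! fst x)((n, \<sigma>) := a)) (\<psi> :: ('s, 'f, 'p) form))"
  \<comment> \<open>\<open>generated\<close> applies operations to all lists, so improper argument
    lists, and below also formulas without a witness, are sent to the default \<open>d0\<close> from
    the starting set.\<close>
  define app where "app = (\<lambda>f as. if as \<in> args A (fst (farity S f)) then fint A f as else d0)"
  define sk where "sk = (\<lambda>(\<psi>, n) as. if \<exists>a. good \<psi> n as a then SOME a. good \<psi> n as a else d0)"
  define ops where "ops = (\<lambda>d _. d) ` D0 \<union> app ` funs S \<union> sk ` ({\<phi>. wf_form S \<phi>} \<times> UNIV)"
  define D where "D = generated ops"
  have "|ops| \<le>o |K|"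
    unfolding ops_def
    by (intro card_of_Un_infinite card_of_image_ordLeq card_of_nat_infinite
        card_of_Times_ordLeq card_of_formulas[OF _ S(2)] sig_card_bounds K S D0 card)
  then have "|D| \<le>o |K|" unfolding D_def by (rule card_of_generated[OF K])
  moreover have sub: "D0 \<subseteq> D" by (auto simp: D_def ops_def intro!: generated_const)
  \<comment> \<open>Case analysis suffices: thanks to the default, every operation maps every list
    into the domain.\<close>
  moreover have "x \<in> dom A \<sigma>" if "x \<in> D" for x
    using that unfolding D_def
  proof cases
    case (1 g xs)
    then consider "x \<in> D0" | f where "f \<in> funs S" "x = app f xs"
      | \<psi> n where "x = sk (\<psi>, n) xs"
      by (auto simp: ops_def)
    then show ?thesis
    proof cases
      case 3
      then show ?thesis
        using d0 D0 someI_ex[of "good \<psi> n xs"] by (auto simp: sk_def good_def)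
    qed (use d0 D0 A in \<open>auto simp: app_def\<close>)
  qed
  moreover have "fint A f as \<in> D"
    if "f \<in> funs S" "as \<in> args A (fst (farity S f))" "set as \<subseteq> D" for f as
  proof -
    have "app f as \<in> D" unfolding D_def
      by (rule generated.intros) (use that in \<open>auto simp: ops_def D_def\<close>)
    then show ?thesis using that by (simp add: app_def)
  qed
  moreover have "\<exists>a\<in>D. sat A (v((n, \<sigma>) := a)) \<psi>"
    if \<psi>: "wf_form S \<psi>" and v: "\<forall>k. v (k, \<sigma>) \<in> D" and ex: "\<exists>a\<in>dom A \<sigma>. sat A (v((n, \<sigma>) := a)) \<psi>"
    for \<psi> v n
  proof -
    \<comment> \<open>All free variables have names below \<open>N\<close>, so the first
      \<open>N\<close> values of \<open>v\<close> at sort \<sigma>, together with the value of the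
      quantified variable, decide the formula.\<close>
    obtain N where N: "\<And>x. x \<in> fv \<psi> \<Longrightarrow> fst x < N"
      using finite_fv[of \<psi>] finite_nat_set_iff_bounded[of "fst ` fv \<psi>"] by auto
    define as where "as = map (\<lambda>k. v (k, \<sigma>)) [0..<N]"
    have eq: "sat A ((\<lambda>x. as ! fst x)((n, \<sigma>) := a)) \<psi> \<longleftrightarrow> sat A (v((n, \<sigma>) := a)) \<psi>" for a
    proof (rule sat_cong)
      fix x assume "x \<in> fv \<psi>"
      moreover from this have "snd x = \<sigma>" using fv_sorts[OF \<psi>] S by auto
      ultimately show "((\<lambda>x. as ! fst x)((n, \<sigma>) := a)) x = (v((n, \<sigma>) := a)) x"
        using N by (cases x) (auto simp: as_def)
    qed
    have "sk (\<psi>, n) as \<in> D" unfolding D_def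
      by (rule generated.intros) (use \<psi> v in \<open>auto simp: ops_def D_def as_def\<close>)
    moreover have "\<exists>a. good \<psi> n as a" using ex by (auto simp: good_def eq)
    then have "good \<psi> n as (sk (\<psi>, n) as)" by (auto simp: sk_def intro: someI_ex)
    ultimately show ?thesis by (auto simp: good_def eq)
  qed
  ultimately show ?thesis using that[of D] by blast
qed


section \<open>Completely split signatures\<close>

text \<open>A function symbol of one part has its arguments and its value in the sort of that part,
  so the subterms of a term never leave its sort.\<close>

lemma has_sort_part:
  assumes "completely_split \<Sigma> \<Sigma>s"
  shows "has_sort \<Sigma> t \<tau> \<Longrightarrow> \<tau> \<in> sorts \<Sigma> \<Longrightarrow> has_sort (\<Sigma>s \<tau>) t \<tau>"
proof (induction rule: has_sort.induct)
  case (Var \<sigma> n)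
  then show ?case using assms by (intro has_sort.Var) (auto simp: completely_split_def)
next
  case (Fn f \<sigma>s \<tau> ts)
  then obtain \<rho> where \<rho>: "\<rho> \<in> sorts \<Sigma>" "f \<in> funs (\<Sigma>s \<rho>)"
    using assms by (auto simp: completely_split_def)
  then have far: "farity (\<Sigma>s \<rho>) f = (\<sigma>s, \<tau>)"
    and wf: "wf_signature (\<Sigma>s \<rho>)" "sorts (\<Sigma>s \<rho>) = {\<rho>}"
    using assms Fn(2) by (auto simp: completely_split_def)
  have "set (fst (farity (\<Sigma>s \<rho>) f)) \<subseteq> sorts (\<Sigma>s \<rho>)" "snd (farity (\<Sigma>s \<rho>) f) \<in> sorts (\<Sigma>s \<rho>)"
    using wf(1) \<rho>(2) unfolding wf_signature_def by blast+
  then have "set \<sigma>s \<subseteq> {\<rho>}" "\<tau> = \<rho>"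
    by (simp_all add: wf far)
  then have "list_all2 (has_sort (\<Sigma>s \<rho>)) ts \<sigma>s"
    using Fn(3) \<rho>(1) by (auto simp: list_all2_conv_all_nth subset_iff in_set_conv_nth)
  then show ?case
    using \<rho> far \<open>\<tau> = \<rho>\<close> by (auto intro: has_sort.Fn)
qed

text \<open>Atoms are already one-sorted; only connectives and quantifiers combine sorts. This is
  the base case of \<open>determined_by_parts\<close>.\<close>

lemma wf_form_part_Rel:
  assumes split: "completely_split \<Sigma> \<Sigma>s" and wf: "wf_form \<Sigma> (Rel p ts)"
  shows "\<exists>\<sigma> \<in> sorts \<Sigma>. wf_form (\<Sigma>s \<sigma>) (Rel p ts)"
proof -
  obtain \<rho> where \<rho>: "\<rho> \<in> sorts \<Sigma>" "p \<in> preds (\<Sigma>s \<rho>)"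
    using assms by (auto simp: completely_split_def)
  then have par: "parity (\<Sigma>s \<rho>) p = parity \<Sigma> p"
    and part: "wf_signature (\<Sigma>s \<rho>)" "sorts (\<Sigma>s \<rho>) = {\<rho>}"
    using split by (auto simp: completely_split_def)
  have "set (parity (\<Sigma>s \<rho>) p) \<subseteq> sorts (\<Sigma>s \<rho>)"
    using part(1) \<rho>(2) unfolding wf_signature_def by blast
  with par part(2) have "set (parity \<Sigma> p) \<subseteq> {\<rho>}" by simp
  then have "list_all2 (has_sort (\<Sigma>s \<rho>)) ts (parity \<Sigma> p)"
    using wf \<rho>(1) has_sort_part[OF split]
    by (auto simp: list_all2_conv_all_nth subset_iff in_set_conv_nth)
  then show ?thesis using \<rho> par by auto
qed

text \<open>One truth pattern on a finite set is a finite conjunction of literals: members of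
  \<open>G\<close> are asserted, the others negated.\<close>

lemma diagram_formula:
  assumes S: "wf_signature S" and "finite F" "\<forall>\<psi>\<in>F. wf_form S \<psi>"
  shows "\<exists>\<chi>. wf_form S \<chi> \<and> (\<forall>(A :: ('s, 'f, 'p, 'a) struct) v.
      sat A v \<chi> \<longleftrightarrow> (\<forall>\<psi>\<in>F. sat A v \<psi> \<longleftrightarrow> \<psi> \<in> G))"
  using assms(2,3)
proof (induction F)
  case empty
  obtain \<sigma> where "\<sigma> \<in> sorts S" using S by (auto simp: wf_signature_def)
  then have "wf_form S (Rel (eqsym S \<sigma>) [Var (0, \<sigma>), Var (0, \<sigma>)])"
    using S by (auto simp: wf_signature_def intro: has_sort.Var)
  \<comment> \<open>The claim ranges over all records, in which \<open>eqsym\<close> need not denote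
    equality; an implication of the form p --> p holds in any case.\<close>
  then show ?case
    by (intro exI[of _ "Imp (Rel (eqsym S \<sigma>) [Var (0, \<sigma>), Var (0, \<sigma>)])
      (Rel (eqsym S \<sigma>) [Var (0, \<sigma>), Var (0, \<sigma>)])"]) simp
next
  case (insert \<psi> F)
  then obtain \<chi> where "wf_form S \<chi>"
    "\<forall>(A :: ('s, 'f, 'p, 'a) struct) v. sat A v \<chi> \<longleftrightarrow> (\<forall>\<psi>\<in>F. sat A v \<psi> \<longleftrightarrow> \<psi> \<in> G)"
    by auto
  with insert show ?case
    by (intro exI[of _ "Conj (if \<psi> \<in> G then \<psi> else Neg \<psi>) \<chi>"]) auto
qed

text \<open>
  In place of a normal form: the truth value of a formula is a function of the truth values of
  finitely many one-sorted formulas. For a quantifier over \<open>\<sigma>\<close>, the new one-sorted formulas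
  say which truth patterns of the old ones of sort \<open>\<sigma>\<close> are realised; those of the other
  sorts do not see the quantified variable.
\<close>

lemma determined_by_parts:
  fixes \<Sigma> :: "('s, 'f, 'p) signature"
  assumes split: "completely_split \<Sigma> \<Sigma>s"
  shows "wf_form \<Sigma> \<phi> \<Longrightarrow> \<exists>F. finite F \<and> (\<forall>\<psi>\<in>F. \<exists>\<sigma>\<in>sorts \<Sigma>. wf_form (\<Sigma>s \<sigma>) \<psi>) \<and>
    (\<forall>(A :: ('s, 'f, 'p, 'a) struct) (B :: ('s, 'f, 'p, 'a) struct) v w.
      (\<forall>\<psi>\<in>F. sat A v \<psi> \<longleftrightarrow> sat B w \<psi>) \<longrightarrow> (sat A v \<phi> \<longleftrightarrow> sat B w \<phi>))"
    (is "_ \<Longrightarrow> ?D \<phi>")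
proof -
  have un: "?D \<phi>" if D: "?D \<psi>"
    and imp: "\<And>(A :: ('s, 'f, 'p, 'a) struct) (B :: ('s, 'f, 'p, 'a) struct) v w.
      sat A v \<psi> = sat B w \<psi> \<Longrightarrow> sat A v \<phi> = sat B w \<phi>" for \<phi> \<psi>
  proof -
    from D obtain F where F: "finite F" "\<forall>\<psi>\<in>F. \<exists>\<sigma>\<in>sorts \<Sigma>. wf_form (\<Sigma>s \<sigma>) \<psi>"
      "\<forall>(A :: ('s, 'f, 'p, 'a) struct) (B :: ('s, 'f, 'p, 'a) struct) v w.
      (\<forall>\<theta>\<in>F. sat A v \<theta> \<longleftrightarrow> sat B w \<theta>) \<longrightarrow> (sat A v \<psi> \<longleftrightarrow> sat B w \<psi>)" by blast
    have "sat A v \<phi> = sat B w \<phi>" if "\<forall>\<theta>\<in>F. sat A v \<theta> \<longleftrightarrow> sat B w \<theta>"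
      for A B :: "('s, 'f, 'p, 'a) struct" and v w
      using F(3) that by (intro imp) simp
    then show ?thesis using F(1,2) by (intro exI[of _ F]) simp
  qed
  have bin: "?D \<phi>" if D: "?D \<psi>1" "?D \<psi>2"
    and imp: "\<And>(A :: ('s, 'f, 'p, 'a) struct) (B :: ('s, 'f, 'p, 'a) struct) v w.
      sat A v \<psi>1 = sat B w \<psi>1 \<Longrightarrow> sat A v \<psi>2 = sat B w \<psi>2 \<Longrightarrow> sat A v \<phi> = sat B w \<phi>"
    for \<phi> \<psi>1 \<psi>2
  proof -
    from D(1) obtain F1 where F1: "finite F1" "\<forall>\<psi>\<in>F1. \<exists>\<sigma>\<in>sorts \<Sigma>. wf_form (\<Sigma>s \<sigma>) \<psi>"
      "\<forall>(A :: ('s, 'f, 'p, 'a) struct) (B :: ('s, 'f, 'p, 'a) struct) v w.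
      (\<forall>\<psi>\<in>F1. sat A v \<psi> \<longleftrightarrow> sat B w \<psi>) \<longrightarrow> (sat A v \<psi>1 \<longleftrightarrow> sat B w \<psi>1)" by blast
    from D(2) obtain F2 where F2: "finite F2" "\<forall>\<psi>\<in>F2. \<exists>\<sigma>\<in>sorts \<Sigma>. wf_form (\<Sigma>s \<sigma>) \<psi>"
      "\<forall>(A :: ('s, 'f, 'p, 'a) struct) (B :: ('s, 'f, 'p, 'a) struct) v w.
      (\<forall>\<psi>\<in>F2. sat A v \<psi> \<longleftrightarrow> sat B w \<psi>) \<longrightarrow> (sat A v \<psi>2 \<longleftrightarrow> sat B w \<psi>2)" by blast
    have "sat A v \<phi> = sat B w \<phi>" if "\<forall>\<psi>\<in>F1 \<union> F2. sat A v \<psi> \<longleftrightarrow> sat B w \<psi>"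
      for A B :: "('s, 'f, 'p, 'a) struct" and v w
      using F1(3) F2(3) that by (intro imp) simp_all
    then show ?thesis using F1(1,2) F2(1,2)
      by (intro exI[of _ "F1 \<union> F2"]) auto
  qed
  have neg: "?D (Neg \<phi>)" if "?D \<phi>" for \<phi>
    by (rule un[OF that]) simp
  have ex: "?D (Ex x \<phi>)" if D: "?D \<phi>" and x: "snd x \<in> sorts \<Sigma>" for x \<phi>
  proof -
    from D obtain F where F: "finite F" "\<forall>\<psi>\<in>F. \<exists>\<sigma>\<in>sorts \<Sigma>. wf_form (\<Sigma>s \<sigma>) \<psi>"
      "\<And>(A :: ('s, 'f, 'p, 'a) struct) (B :: ('s, 'f, 'p, 'a) struct) v w.
      \<forall>\<psi>\<in>F. sat A v \<psi> \<longleftrightarrow> sat B w \<psi> \<Longrightarrow> sat A v \<phi> \<longleftrightarrow> sat B w \<phi>" by blast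
    define S where "S = \<Sigma>s (snd x)"
    define Fx where "Fx = {\<psi> \<in> F. wf_form S \<psi>}"
    have S: "wf_signature S" "sorts S = {snd x}"
      using split x by (auto simp: completely_split_def S_def)
    have "\<forall>G. \<exists>\<chi>. wf_form S \<chi> \<and> (\<forall>(A :: ('s, 'f, 'p, 'a) struct) v.
      sat A v \<chi> \<longleftrightarrow> (\<forall>\<psi>\<in>Fx. sat A v \<psi> \<longleftrightarrow> \<psi> \<in> G))"
      by (intro allI diagram_formula[OF S(1)]) (use F(1) in \<open>simp_all add: Fx_def\<close>)
    from choice[OF this] obtain \<chi> where all_\<chi>: "\<forall>G. wf_form S (\<chi> G) \<and>
      (\<forall>(A :: ('s, 'f, 'p, 'a) struct) v. sat A v (\<chi> G) \<longleftrightarrow> (\<forall>\<psi>\<in>Fx. sat A v \<psi> \<longleftrightarrow> \<psi> \<in> G))" ..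
    have \<chi>: "wf_form S (\<chi> G)" "sat A v (\<chi> G) \<longleftrightarrow> (\<forall>\<psi>\<in>Fx. sat A v \<psi> \<longleftrightarrow> \<psi> \<in> G)"
      for G and A :: "('s, 'f, 'p, 'a) struct" and v
      using spec[OF all_\<chi>, of G] by simp_all
    let ?F = "(F - Fx) \<union> (\<lambda>G. Ex x (\<chi> G)) ` Pow Fx"
    have other: "sat A (v(x := a)) \<psi> \<longleftrightarrow> sat A v \<psi>" if "\<psi> \<in> F - Fx"
      for A :: "('s, 'f, 'p, 'a) struct" and v a \<psi>
    proof (rule sat_cong)
      fix y assume y: "y \<in> fv \<psi>"
      obtain \<tau> where \<tau>: "\<tau> \<in> sorts \<Sigma>" "wf_form (\<Sigma>s \<tau>) \<psi>" using F(2) \<open>\<psi> \<in> F - Fx\<close> by blast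
      then have "\<tau> \<noteq> snd x" using \<open>\<psi> \<in> F - Fx\<close> by (auto simp: Fx_def S_def)
      moreover have "snd y = \<tau>"
        using fv_sorts[OF \<tau>(2) y] split \<tau>(1) by (auto simp: completely_split_def)
      ultimately show "(v(x := a)) y = v y" by auto
    qed
    have one: "sat B w (Ex x \<phi>)"
      if agree: "\<forall>\<psi>\<in>?F. sat A v \<psi> \<longleftrightarrow> sat B w \<psi>" and sat: "sat A v (Ex x \<phi>)"
      for A B :: "('s, 'f, 'p, 'a) struct" and v w
    proof -
      obtain a where a: "a \<in> dom A (snd x)" "sat A (v(x := a)) \<phi>" using sat by auto
      \<comment> \<open>The truth pattern of the witness \<open>a\<close>. Agreement on
        \<open>Ex x (\<chi> G)\<close> yields some \<open>b\<close> in the other structure with the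
        same pattern; the converse direction follows by symmetry.\<close>
      define G where "G = {\<psi> \<in> Fx. sat A (v(x := a)) \<psi>}"
      have "sat A (v(x := a)) (\<chi> G)" by (auto simp: \<chi> G_def)
      then have "sat A v (Ex x (\<chi> G))" using a by auto
      moreover have "Ex x (\<chi> G) \<in> ?F" by (auto simp: G_def)
      ultimately have "sat B w (Ex x (\<chi> G))" using agree by blast
      then obtain b where b: "b \<in> dom B (snd x)" "sat B (w(x := b)) (\<chi> G)" by auto
      have "sat A (v(x := a)) \<psi> \<longleftrightarrow> sat B (w(x := b)) \<psi>" if "\<psi> \<in> F" for \<psi>
      proof (cases "\<psi> \<in> Fx")
        case True
        then show ?thesis using b(2) unfolding \<chi> by (auto simp: G_def)
      next
        case False
        then show ?thesis using agree other that by blast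
      qed
      then have "sat B (w(x := b)) \<phi>" using F(3) a(2) by blast
      then show ?thesis using b(1) by auto
    qed
    have agree: "sat A v (Ex x \<phi>) \<longleftrightarrow> sat B w (Ex x \<phi>)"
      if "\<forall>\<psi>\<in>?F. sat A v \<psi> \<longleftrightarrow> sat B w \<psi>"
      for A B :: "('s, 'f, 'p, 'a) struct" and v w
      using one[of A v B w] one[of B w A v] that by blast
    have fin: "finite ?F" using F(1) by (auto simp: Fx_def)
    have parts: "\<forall>\<psi>\<in>?F. \<exists>\<sigma>\<in>sorts \<Sigma>. wf_form (\<Sigma>s \<sigma>) \<psi>"
    proof -
      have "wf_form (\<Sigma>s (snd x)) (Ex x (\<chi> G))" for G
        using \<chi>(1)[of G] S by (simp add: S_def)
      then show ?thesis using F(2) x by blast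
    qed
    show ?thesis by (intro exI[of _ ?F] conjI allI impI fin parts agree)
  qed
  show "wf_form \<Sigma> \<phi> \<Longrightarrow> ?D \<phi>"
  proof (induction \<phi>)
    case (Rel p ts)
    from wf_form_part_Rel[OF split this] show ?case
      by (intro exI[of _ "{Rel p ts}"]) simp
  next
    case (Neg \<phi>)
    from Neg.prems have "wf_form \<Sigma> \<phi>" by simp
    from neg[OF Neg.IH[OF this]] show ?case .
  next
    case (Conj \<phi> \<psi>)
    from Conj.prems have "wf_form \<Sigma> \<phi>" "wf_form \<Sigma> \<psi>" by simp_all
    from Conj.IH(1)[OF this(1)] Conj.IH(2)[OF this(2)] show ?case by (rule bin) simp
  next
    case (Disj \<phi> \<psi>)
    from Disj.prems have "wf_form \<Sigma> \<phi>" "wf_form \<Sigma> \<psi>" by simp_all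
    from Disj.IH(1)[OF this(1)] Disj.IH(2)[OF this(2)] show ?case by (rule bin) simp
  next
    case (Imp \<phi> \<psi>)
    from Imp.prems have "wf_form \<Sigma> \<phi>" "wf_form \<Sigma> \<psi>" by simp_all
    from Imp.IH(1)[OF this(1)] Imp.IH(2)[OF this(2)] show ?case by (rule bin) simp
  next
    case (All x \<phi>)
    from All.prems have "wf_form \<Sigma> \<phi>" "snd x \<in> sorts \<Sigma>" by simp_all
    from neg[OF ex[OF neg[OF All.IH[OF this(1)]] this(2)]] show ?case by (rule un) simp
  next
    case (Ex x \<phi>)
    from Ex.prems have "wf_form \<Sigma> \<phi>" "snd x \<in> sorts \<Sigma>" by simp_all
    from ex[OF Ex.IH[OF this(1)] this(2)] show ?case .
  qed
qed

text \<open>The Tarski-Vaught criterion is available only for one-sorted formulas, so elementarity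
  is shown for these and carried to sentences by \<open>determined_by_parts\<close>. The sets
  \<open>D0\<close> later bound the domains from below.\<close>

lemma elementary_substructure:
  fixes A :: "('s, 'f, 'p, 'a) struct" and K :: "'s \<Rightarrow> 'k set"
  assumes wf: "wf_signature \<Sigma>" and split: "completely_split \<Sigma> \<Sigma>s" and A: "is_structure \<Sigma> A"
    and K: "\<And>\<sigma>. \<sigma> \<in> sorts \<Sigma> \<Longrightarrow> infinite (K \<sigma>)"
    and card: "\<And>\<sigma>. \<sigma> \<in> sorts \<Sigma> \<Longrightarrow> sig_card (\<Sigma>s \<sigma>) \<le>o |K \<sigma>|"
    and D0: "\<And>\<sigma>. \<sigma> \<in> sorts \<Sigma> \<Longrightarrow> D0 \<sigma> \<subseteq> dom A \<sigma> \<and> D0 \<sigma> \<noteq> {} \<and> |D0 \<sigma>| \<le>o |K \<sigma>|"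
  obtains D where "\<And>\<sigma>. \<sigma> \<in> sorts \<Sigma> \<Longrightarrow> D0 \<sigma> \<subseteq> D \<sigma> \<and> D \<sigma> \<subseteq> dom A \<sigma> \<and> |D \<sigma>| \<le>o |K \<sigma>|"
    "is_structure \<Sigma> (A\<lparr>dom := D\<rparr>)"
    "\<And>\<phi>. sentence \<Sigma> \<phi> \<Longrightarrow> satisfies \<Sigma> (A\<lparr>dom := D\<rparr>) \<phi> \<longleftrightarrow> satisfies \<Sigma> A \<phi>"
proof -
  let ?H = "\<lambda>\<sigma> D. D0 \<sigma> \<subseteq> D \<and> D \<subseteq> dom A \<sigma> \<and> |D| \<le>o |K \<sigma>| \<and>
    (\<forall>f as. f \<in> funs (\<Sigma>s \<sigma>) \<longrightarrow> as \<in> args A (fst (farity (\<Sigma>s \<sigma>) f)) \<longrightarrow> set as \<subseteq> D \<longrightarrow>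
      fint A f as \<in> D) \<and>
    (\<forall>\<psi> v n. wf_form (\<Sigma>s \<sigma>) \<psi> \<longrightarrow> (\<forall>k. v (k, \<sigma>) \<in> D) \<longrightarrow>
       (\<exists>a\<in>dom A \<sigma>. sat A (v((n, \<sigma>) := a)) \<psi>) \<longrightarrow> (\<exists>a\<in>D. sat A (v((n, \<sigma>) := a)) \<psi>))"
  have part: "wf_signature (\<Sigma>s \<sigma>)" "sorts (\<Sigma>s \<sigma>) = {\<sigma>}"
    "\<And>f. f \<in> funs (\<Sigma>s \<sigma>) \<Longrightarrow> farity (\<Sigma>s \<sigma>) f = farity \<Sigma> f \<and> f \<in> funs \<Sigma> \<and>
      set (fst (farity \<Sigma> f)) \<subseteq> {\<sigma>} \<and> snd (farity \<Sigma> f) = \<sigma>"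
    if "\<sigma> \<in> sorts \<Sigma>" for \<sigma>
  proof -
    show *: "wf_signature (\<Sigma>s \<sigma>)" "sorts (\<Sigma>s \<sigma>) = {\<sigma>}"
      using split that by (auto simp: completely_split_def)
    fix f assume f: "f \<in> funs (\<Sigma>s \<sigma>)"
    have "farity (\<Sigma>s \<sigma>) f = farity \<Sigma> f" "f \<in> funs \<Sigma>"
      using split that f by (auto simp: completely_split_def)
    moreover have "set (fst (farity (\<Sigma>s \<sigma>) f)) \<subseteq> sorts (\<Sigma>s \<sigma>)"
      "snd (farity (\<Sigma>s \<sigma>) f) \<in> sorts (\<Sigma>s \<sigma>)"
      using *(1) f unfolding wf_signature_def by blast+
    ultimately show "farity (\<Sigma>s \<sigma>) f = farity \<Sigma> f \<and> f \<in> funs \<Sigma> \<and>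
      set (fst (farity \<Sigma> f)) \<subseteq> {\<sigma>} \<and> snd (farity \<Sigma> f) = \<sigma>"
      by (simp add: *)
  qed
  have "\<exists>D. ?H \<sigma> D" if \<sigma>: "\<sigma> \<in> sorts \<Sigma>" for \<sigma>
  proof -
    have "fint A f as \<in> dom A \<sigma>"
      if "f \<in> funs (\<Sigma>s \<sigma>)" "as \<in> args A (fst (farity (\<Sigma>s \<sigma>) f))" for f as
      using part(3)[OF \<sigma> that(1)] that(2) A by (auto simp: is_structure_def)
    from skolem_hull[OF part(1,2)[OF \<sigma>] card[OF \<sigma>] K[OF \<sigma>] _ _ _ this, of "D0 \<sigma>"] D0[OF \<sigma>]
    obtain D where "D0 \<sigma> \<subseteq> D" "D \<subseteq> dom A \<sigma>" "|D| \<le>o |K \<sigma>|"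
      "\<And>f as. f \<in> funs (\<Sigma>s \<sigma>) \<Longrightarrow> as \<in> args A (fst (farity (\<Sigma>s \<sigma>) f)) \<Longrightarrow> set as \<subseteq> D \<Longrightarrow>
        fint A f as \<in> D"
      "\<And>\<psi> v n. wf_form (\<Sigma>s \<sigma>) \<psi> \<Longrightarrow> \<forall>k. v (k, \<sigma>) \<in> D \<Longrightarrow>
         \<exists>a\<in>dom A \<sigma>. sat A (v((n, \<sigma>) := a)) \<psi> \<Longrightarrow> \<exists>a\<in>D. sat A (v((n, \<sigma>) := a)) \<psi>"
      by metis
    then show ?thesis by (intro exI[of _ D]) blast
  qed
  then have "\<forall>\<sigma>\<in>sorts \<Sigma>. \<exists>D. ?H \<sigma> D" by (rule ballI)
  from bchoice[OF this] obtain D where "\<forall>\<sigma>\<in>sorts \<Sigma>. ?H \<sigma> (D \<sigma>)" ..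
  then have D: "?H \<sigma> (D \<sigma>)" if "\<sigma> \<in> sorts \<Sigma>" for \<sigma> using that by (rule bspec)
  have D_sub: "D0 \<sigma> \<subseteq> D \<sigma>" "D \<sigma> \<subseteq> dom A \<sigma>" "|D \<sigma>| \<le>o |K \<sigma>|" if "\<sigma> \<in> sorts \<Sigma>" for \<sigma>
    using D[OF that] by simp_all
  have D_fint: "fint A f as \<in> D \<sigma>"
    if "\<sigma> \<in> sorts \<Sigma>" "f \<in> funs (\<Sigma>s \<sigma>)" "as \<in> args A (fst (farity (\<Sigma>s \<sigma>) f))" "set as \<subseteq> D \<sigma>"
    for \<sigma> f as
    using D[OF that(1)] that(2-4) by simp
  have D_witness: "\<exists>a\<in>D \<sigma>. sat A (v((n, \<sigma>) := a)) \<psi>"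
    if "\<sigma> \<in> sorts \<Sigma>" "wf_form (\<Sigma>s \<sigma>) \<psi>" "\<forall>k. v (k, \<sigma>) \<in> D \<sigma>"
      "\<exists>a\<in>dom A \<sigma>. sat A (v((n, \<sigma>) := a)) \<psi>" for \<sigma> \<psi> v n
    using D[OF that(1)] that(2-4) by simp
  \<comment> \<open>Quantifiers and argument lists refer to the domains alone, so the
    interpretations are kept and terms evaluate as before.\<close>
  define B where "B = A\<lparr>dom := D\<rparr>"
  have B_simps: "dom B = D" "fint B = fint A" "pint B = pint A" by (simp_all add: B_def)
  have B: "is_structure \<Sigma> B"
    unfolding is_structure_def B_simps
  proof (intro conjI ballI)
    fix \<sigma> assume "\<sigma> \<in> sorts \<Sigma>"
    then show "D \<sigma> \<noteq> {}" using D_sub(1)[of \<sigma>] D0[of \<sigma>] by auto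
  next
    fix f as assume f: "f \<in> funs \<Sigma>" and as: "as \<in> args B (fst (farity \<Sigma> f))"
    obtain \<sigma> where \<sigma>: "\<sigma> \<in> sorts \<Sigma>" "f \<in> funs (\<Sigma>s \<sigma>)"
      using f split by (auto simp: completely_split_def)
    note p = part(3)[OF this]
    then have "set as \<subseteq> D \<sigma>"
      using as by (force simp: args_def B_simps list_all2_conv_all_nth in_set_conv_nth subset_iff)
    moreover have "as \<in> args A (fst (farity (\<Sigma>s \<sigma>) f))"
      using as p D_sub(2)[OF \<sigma>(1)]
      unfolding args_def B_simps mem_Collect_eq
      by (fastforce simp: list_all2_conv_all_nth subset_iff in_set_conv_nth)
    ultimately show "fint A f as \<in> D (snd (farity \<Sigma> f))"
      using D_fint[OF \<sigma>] p by simp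
  next
    fix \<sigma> a b assume "\<sigma> \<in> sorts \<Sigma>" "a \<in> D \<sigma>" "b \<in> D \<sigma>"
    then show "pint A (eqsym \<Sigma> \<sigma>) [a, b] \<longleftrightarrow> a = b"
      using D_sub(2)[of \<sigma>] A unfolding is_structure_def by blast
  qed
  have eval: "eval B v t = eval A v t" for v t
    by (induction t) (simp_all add: B_simps cong: map_cong)
  have pure: "wf_form (\<Sigma>s \<sigma>) \<psi> \<Longrightarrow> \<forall>k. v (k, \<sigma>) \<in> D \<sigma> \<Longrightarrow> sat B v \<psi> \<longleftrightarrow> sat A v \<psi>"
    if \<sigma>: "\<sigma> \<in> sorts \<Sigma>" for \<sigma> \<psi> v
  proof (induction \<psi> arbitrary: v)
    case (Rel p ts)
    have "eval B v = eval A v" using eval by blast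
    then show ?case by (simp add: B_simps)
  next
    case (All x \<psi>)
    then obtain n where x: "x = (n, \<sigma>)" and \<psi>: "wf_form (\<Sigma>s \<sigma>) (Neg \<psi>)"
      using part(2)[OF \<sigma>] by (cases x) auto
    have "sat B (v(x := a)) \<psi> \<longleftrightarrow> sat A (v(x := a)) \<psi>" if "a \<in> D \<sigma>" for a
      using All that by (intro All.IH) (auto simp: x)
    \<comment> \<open>A counterexample in the large domain can be moved into the hull, which gives
      the direction from \<open>B\<close> to \<open>A\<close>.\<close>
    moreover have "\<exists>a\<in>D \<sigma>. sat A (v(x := a)) (Neg \<psi>)"
      if "\<exists>a\<in>dom A \<sigma>. sat A (v(x := a)) (Neg \<psi>)"
      using D_witness[OF \<sigma> \<psi> All.prems(2)] that unfolding x by blast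
    ultimately show ?case using D_sub(2)[OF \<sigma>] by (fastforce simp: B_simps x)
  next
    case (Ex x \<psi>)
    then obtain n where x: "x = (n, \<sigma>)" and \<psi>: "wf_form (\<Sigma>s \<sigma>) \<psi>"
      using part(2)[OF \<sigma>] by (cases x) auto
    have "sat B (v(x := a)) \<psi> \<longleftrightarrow> sat A (v(x := a)) \<psi>" if "a \<in> D \<sigma>" for a
      using Ex that by (intro Ex.IH) (auto simp: x)
    moreover have "\<exists>a\<in>D \<sigma>. sat A (v(x := a)) \<psi>"
      if "\<exists>a\<in>dom A \<sigma>. sat A (v(x := a)) \<psi>"
      using D_witness[OF \<sigma> \<psi> Ex.prems(2)] that unfolding x by blast
    ultimately show ?case using D_sub(2)[OF \<sigma>] by (auto simp: B_simps x)
  qed simp_all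
  have "satisfies \<Sigma> B \<phi> \<longleftrightarrow> satisfies \<Sigma> A \<phi>" if \<phi>: "sentence \<Sigma> \<phi>" for \<phi>
  proof -
    \<comment> \<open>A single valuation meeting every hull, so that \<open>pure\<close> applies to
      the pieces of all sorts at once.\<close>
    define v where "v = (\<lambda>x :: 's var. SOME a. a \<in> D (snd x))"
    have v: "v (k, \<sigma>) \<in> D \<sigma>" if "\<sigma> \<in> sorts \<Sigma>" for k \<sigma>
      using B that by (auto simp: v_def is_structure_def some_in_eq B_simps)
    have "wf_form \<Sigma> \<phi>" using \<phi> by (simp add: sentence_def)
    from determined_by_parts[OF split this]
    obtain F where F: "\<forall>\<psi>\<in>F. \<exists>\<sigma>\<in>sorts \<Sigma>. wf_form (\<Sigma>s \<sigma>) \<psi>"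
      "\<forall>(A :: ('s, 'f, 'p, 'a) struct) (B :: ('s, 'f, 'p, 'a) struct) v w.
      (\<forall>\<psi>\<in>F. sat A v \<psi> \<longleftrightarrow> sat B w \<psi>) \<longrightarrow> (sat A v \<phi> \<longleftrightarrow> sat B w \<phi>)" by blast
    have "sat B v \<psi> \<longleftrightarrow> sat A v \<psi>" if "\<psi> \<in> F" for \<psi>
      using F(1) that pure v by blast
    then have "sat B v \<phi> \<longleftrightarrow> sat A v \<phi>" using F(2) by simp
    then show ?thesis using satisfies_sentence[OF A \<phi>, of v] satisfies_sentence[OF B \<phi>, of v] by simp
  qed
  then show ?thesis using that[of D] D_sub B by (simp add: B_def)
qed


section \<open>Isomorphisms and the completeness theorem\<close>

lemma isomorphic_satisfies:
  fixes A :: "('s, 'f, 'p, 'a) struct" and B :: "('s, 'f, 'p, 'b) struct"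
  assumes A: "is_structure \<Sigma> A" and B: "is_structure \<Sigma> B" and iso: "isomorphic \<Sigma> A B"
    and \<phi>: "sentence \<Sigma> \<phi>"
  shows "satisfies \<Sigma> A \<phi> \<longleftrightarrow> satisfies \<Sigma> B \<phi>"
proof -
  obtain h where bij: "\<And>\<sigma>. \<sigma> \<in> sorts \<Sigma> \<Longrightarrow> bij_betw (h \<sigma>) (dom A \<sigma>) (dom B \<sigma>)"
    and fint: "\<And>f as. f \<in> funs \<Sigma> \<Longrightarrow> as \<in> args A (fst (farity \<Sigma> f)) \<Longrightarrow>
           h (snd (farity \<Sigma> f)) (fint A f as) = fint B f (map2 h (fst (farity \<Sigma> f)) as)"
    and pint: "\<And>p as. p \<in> preds \<Sigma> \<Longrightarrow> as \<in> args A (parity \<Sigma> p) \<Longrightarrow>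
           pint A p as \<longleftrightarrow> pint B p (map2 h (parity \<Sigma> p) as)"
    using iso unfolding isomorphic_def by blast
  \<comment> \<open>The bijection is selected by the sort of the variable, since an element may
    belong to several domains.\<close>
  define H where "H = (\<lambda>v (x :: 's var). h (snd x) (v x :: 'a))"
  have eval_list: "map (eval A v) ts \<in> args A \<sigma>s \<and>
      map (eval B (H v)) ts = map2 h \<sigma>s (map (eval A v) ts)"
    if "list_all2 (\<lambda>t \<tau>. eval A v t \<in> dom A \<tau> \<and> eval B (H v) t = h \<tau> (eval A v t)) ts \<sigma>s"
    for v ts \<sigma>s
    using that by (induction rule: list_all2_induct) (auto simp: args_def)
  have eval: "eval A v t \<in> dom A \<tau> \<and> eval B (H v) t = h \<tau> (eval A v t)"
    if v: "assignment \<Sigma> A v" and t: "has_sort \<Sigma> t \<tau>" for v t \<tau>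
    using t
  proof (induction rule: has_sort.induct)
    case (Var \<sigma> n)
    then show ?case using v by (simp add: assignment_def H_def)
  next
    case (Fn f \<sigma>s \<sigma> ts)
    have "list_all2 (\<lambda>t \<tau>. eval A v t \<in> dom A \<tau> \<and> eval B (H v) t = h \<tau> (eval A v t)) ts \<sigma>s"
      using Fn(3) by (rule list.rel_mono_strong) simp
    note * = eval_list[OF this]
    then have "fint A f (map (eval A v) ts) \<in> dom A \<sigma>"
      using A Fn(1,2) unfolding is_structure_def by (metis fst_conv snd_conv)
    moreover have "h \<sigma> (fint A f (map (eval A v) ts)) = fint B f (map (eval B (H v)) ts)"
      using fint[of f "map (eval A v) ts"] Fn(1,2) * by simp
    ultimately show ?case by simp
  qed
  have sat: "assignment \<Sigma> A v \<Longrightarrow> wf_form \<Sigma> \<psi> \<Longrightarrow> sat A v \<psi> \<longleftrightarrow> sat B (H v) \<psi>" for v \<psi>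
  proof (induction \<psi> arbitrary: v)
    case (Rel p ts)
    have "list_all2 (\<lambda>t \<tau>. eval A v t \<in> dom A \<tau> \<and> eval B (H v) t = h \<tau> (eval A v t))
        ts (parity \<Sigma> p)"
    proof (rule list.rel_mono_strong)
      show "list_all2 (has_sort \<Sigma>) ts (parity \<Sigma> p)" using Rel.prems(2) by simp
    qed (rule eval[OF Rel.prems(1)])
    from eval_list[OF this] show ?case
      using Rel.prems(2) pint[of p "map (eval A v) ts"] by simp
  next
    case (All x \<psi>)
    then have x: "snd x \<in> sorts \<Sigma>" by simp
    have "sat A (v(x := a)) \<psi> \<longleftrightarrow> sat B ((H v)(x := h (snd x) a)) \<psi>" if "a \<in> dom A (snd x)" for a
    proof -
      have "assignment \<Sigma> A (v(x := a))" using All.prems that by (auto simp: assignment_def)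
      moreover have "H (v(x := a)) = (H v)(x := h (snd x) a)" by (auto simp: H_def fun_eq_iff)
      moreover have "wf_form \<Sigma> \<psi>" using All.prems by simp
      ultimately show ?thesis using All.IH[of "v(x := a)"] by (simp only:)
    qed
    moreover have "dom B (snd x) = h (snd x) ` dom A (snd x)"
      using bij[OF x] by (simp add: bij_betw_def)
    ultimately show ?case by simp
  next
    case (Ex x \<psi>)
    then have x: "snd x \<in> sorts \<Sigma>" by simp
    have "sat A (v(x := a)) \<psi> \<longleftrightarrow> sat B ((H v)(x := h (snd x) a)) \<psi>" if "a \<in> dom A (snd x)" for a
    proof -
      have "assignment \<Sigma> A (v(x := a))" using Ex.prems that by (auto simp: assignment_def)
      moreover have "H (v(x := a)) = (H v)(x := h (snd x) a)" by (auto simp: H_def fun_eq_iff)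
      moreover have "wf_form \<Sigma> \<psi>" using Ex.prems by simp
      ultimately show ?thesis using Ex.IH[of "v(x := a)"] by (simp only:)
    qed
    moreover have "dom B (snd x) = h (snd x) ` dom A (snd x)"
      using bij[OF x] by (simp add: bij_betw_def)
    ultimately show ?case by simp
  qed simp_all
  define v where "v = (\<lambda>x :: 's var. SOME a. a \<in> dom A (snd x))"
  have "assignment \<Sigma> A v"
    using A by (auto simp: assignment_def v_def is_structure_def some_in_eq)
  then have "sat A v \<phi> \<longleftrightarrow> sat B (H v) \<phi>" using \<phi> by (intro sat) (simp_all add: sentence_def)
  then show ?thesis
    using satisfies_sentence[OF A \<phi>, of v] satisfies_sentence[OF B \<phi>, of "H v"] by simp
qed

text \<open>Pulling arguments back along the inverses of \<open>h\<close> makes \<open>h\<close> an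
  isomorphism; the purpose is to change the universe type. Injectivity is asked sort by sort, so
  images of different sorts may overlap and the arity selects the inverse.\<close>

lemma transport_structure:
  fixes A :: "('s, 'f, 'p, 'a) struct" and h :: "'s \<Rightarrow> 'a \<Rightarrow> 'b"
  assumes wf: "wf_signature \<Sigma>" and A: "is_structure \<Sigma> A"
    and inj: "\<And>\<sigma>. \<sigma> \<in> sorts \<Sigma> \<Longrightarrow> inj_on (h \<sigma>) (dom A \<sigma>)"
  obtains B :: "('s, 'f, 'p, 'b) struct" where "is_structure \<Sigma> B" "isomorphic \<Sigma> A B"
    "\<And>\<sigma>. dom B \<sigma> = h \<sigma> ` dom A \<sigma>"
proof -
  define g where "g = (\<lambda>\<sigma>. inv_into (dom A \<sigma>) (h \<sigma>))"
  have gh: "g \<sigma> (h \<sigma> a) = a" if "\<sigma> \<in> sorts \<Sigma>" "a \<in> dom A \<sigma>" for \<sigma> a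
    using inj[OF that(1)] that(2) by (simp add: g_def)
  define B :: "('s, 'f, 'p, 'b) struct" where "B =
    \<lparr>dom = \<lambda>\<sigma>. h \<sigma> ` dom A \<sigma>,
     fint = \<lambda>f bs. h (snd (farity \<Sigma> f)) (fint A f (map2 g (fst (farity \<Sigma> f)) bs)),
     pint = \<lambda>p bs. pint A p (map2 g (parity \<Sigma> p) bs)\<rparr>"
  have map_gh: "map2 g \<sigma>s (map2 h \<sigma>s as) = as"
    if "set \<sigma>s \<subseteq> sorts \<Sigma>" "as \<in> args A \<sigma>s" for \<sigma>s as
    using that(2,1) unfolding args_def mem_Collect_eq
    by (induction rule: list_all2_induct) (auto simp: gh)
  have args_B: "map2 g \<sigma>s bs \<in> args A \<sigma>s"
    if "set \<sigma>s \<subseteq> sorts \<Sigma>" "bs \<in> args B \<sigma>s" for \<sigma>s bs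
    using that(2,1) unfolding args_def mem_Collect_eq
    by (induction rule: list_all2_induct) (auto simp: gh B_def)
  have far: "set (fst (farity \<Sigma> f)) \<subseteq> sorts \<Sigma>" if "f \<in> funs \<Sigma>" for f
    using wf that unfolding wf_signature_def by blast
  have par: "set (parity \<Sigma> p) \<subseteq> sorts \<Sigma>" if "p \<in> preds \<Sigma>" for p
    using wf that unfolding wf_signature_def by blast
  have eq: "parity \<Sigma> (eqsym \<Sigma> \<sigma>) = [\<sigma>, \<sigma>]" if "\<sigma> \<in> sorts \<Sigma>" for \<sigma>
    using wf that unfolding wf_signature_def by blast
  have "is_structure \<Sigma> B"
    unfolding is_structure_def
  proof (intro conjI ballI)
    fix \<sigma> assume "\<sigma> \<in> sorts \<Sigma>"
    then show "dom B \<sigma> \<noteq> {}" using A by (simp add: is_structure_def B_def)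
  next
    fix f bs assume f: "f \<in> funs \<Sigma>" "bs \<in> args B (fst (farity \<Sigma> f))"
    have "fint A f (map2 g (fst (farity \<Sigma> f)) bs) \<in> dom A (snd (farity \<Sigma> f))"
      using A f(1) args_B[OF far f(2)] unfolding is_structure_def by blast
    then show "fint B f bs \<in> dom B (snd (farity \<Sigma> f))" by (simp add: B_def)
  next
    fix \<sigma> b c assume \<sigma>: "\<sigma> \<in> sorts \<Sigma>" and "b \<in> dom B \<sigma>" "c \<in> dom B \<sigma>"
    then obtain a d where ad: "a \<in> dom A \<sigma>" "d \<in> dom A \<sigma>" "b = h \<sigma> a" "c = h \<sigma> d"
      by (auto simp: B_def)
    have "pint A (eqsym \<Sigma> \<sigma>) [a, d] \<longleftrightarrow> a = d"
      using A \<sigma> ad unfolding is_structure_def by blast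
    then show "pint B (eqsym \<Sigma> \<sigma>) [b, c] \<longleftrightarrow> b = c"
      using ad inj_on_eq_iff[OF inj[OF \<sigma>]] by (simp add: B_def eq \<sigma> gh)
  qed
  moreover have "isomorphic \<Sigma> A B"
    unfolding isomorphic_def
  proof (intro exI[of _ h] conjI ballI)
    fix \<sigma> assume "\<sigma> \<in> sorts \<Sigma>"
    then show "bij_betw (h \<sigma>) (dom A \<sigma>) (dom B \<sigma>)"
      using inj by (simp add: bij_betw_def B_def)
  next
    fix f as assume "f \<in> funs \<Sigma>" "as \<in> args A (fst (farity \<Sigma> f))"
    then show "h (snd (farity \<Sigma> f)) (fint A f as) = fint B f (map2 h (fst (farity \<Sigma> f)) as)"
      using map_gh[OF far] by (simp add: B_def)
  next
    fix p as assume "p \<in> preds \<Sigma>" "as \<in> args A (parity \<Sigma> p)"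
    then show "pint A p as \<longleftrightarrow> pint B p (map2 h (parity \<Sigma> p) as)"
      using map_gh[OF par] by (simp add: B_def)
  qed
  moreover have "dom B \<sigma> = h \<sigma> ` dom A \<sigma>" for \<sigma> by (simp add: B_def)
  ultimately show ?thesis by (rule that)
qed

text \<open>The hulls embed into the sets \<open>K \<sigma>\<close>, so the elementary substructure
  can be copied into the type of \<open>K\<close>. It serves twice: with singletons
  \<open>D0\<close>, to compare a model of another universe with one in \<open>'u\<close>, and with
  \<open>D0 \<sigma>\<close> as large as \<open>K \<sigma>\<close>, to hit a cardinality
  exactly.\<close>

lemma small_equivalent_model:
  fixes A :: "('s, 'f, 'p, 'a) struct" and K :: "'s \<Rightarrow> 'u set"
  assumes wf: "wf_signature \<Sigma>" and split: "completely_split \<Sigma> \<Sigma>s" and T: "is_theory \<Sigma> T"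
    and A: "is_model \<Sigma> T A"
    and K: "\<And>\<sigma>. \<sigma> \<in> sorts \<Sigma> \<Longrightarrow> infinite (K \<sigma>)"
    and card: "\<And>\<sigma>. \<sigma> \<in> sorts \<Sigma> \<Longrightarrow> sig_card (\<Sigma>s \<sigma>) \<le>o |K \<sigma>|"
    and D0: "\<And>\<sigma>. \<sigma> \<in> sorts \<Sigma> \<Longrightarrow> D0 \<sigma> \<subseteq> dom A \<sigma> \<and> D0 \<sigma> \<noteq> {} \<and> |D0 \<sigma>| \<le>o |K \<sigma>|"
  shows "\<exists>B :: ('s, 'f, 'p, 'u) struct. is_model \<Sigma> T B \<and>
    (\<forall>\<phi>. sentence \<Sigma> \<phi> \<longrightarrow> satisfies \<Sigma> B \<phi> = satisfies \<Sigma> A \<phi>) \<and>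
    (\<forall>\<sigma> \<in> sorts \<Sigma>. |D0 \<sigma>| \<le>o |dom B \<sigma>| \<and> |dom B \<sigma>| \<le>o |dom A \<sigma>| \<and> |dom B \<sigma>| \<le>o |K \<sigma>| )"
proof -
  have str: "is_structure \<Sigma> A" using A by (simp add: is_model_def)
  obtain D where D: "\<And>\<sigma>. \<sigma> \<in> sorts \<Sigma> \<Longrightarrow> D0 \<sigma> \<subseteq> D \<sigma> \<and> D \<sigma> \<subseteq> dom A \<sigma> \<and> |D \<sigma>| \<le>o |K \<sigma>|"
    and E: "is_structure \<Sigma> (A\<lparr>dom := D\<rparr>)"
    "\<And>\<phi>. sentence \<Sigma> \<phi> \<Longrightarrow> satisfies \<Sigma> (A\<lparr>dom := D\<rparr>) \<phi> \<longleftrightarrow> satisfies \<Sigma> A \<phi>"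
    using elementary_substructure[where K = K, OF wf split str K card D0] by blast
  have "\<forall>\<sigma>\<in>sorts \<Sigma>. \<exists>h. inj_on h (D \<sigma>) \<and> h ` D \<sigma> \<subseteq> K \<sigma>"
    using D card_of_ordLeq by blast
  from bchoice[OF this] obtain h where h: "\<forall>\<sigma>\<in>sorts \<Sigma>. inj_on (h \<sigma>) (D \<sigma>) \<and> h \<sigma> ` D \<sigma> \<subseteq> K \<sigma>" ..
  obtain B :: "('s, 'f, 'p, 'u) struct" where B: "is_structure \<Sigma> B"
    "isomorphic \<Sigma> (A\<lparr>dom := D\<rparr>) B" "\<And>\<sigma>. dom B \<sigma> = h \<sigma> ` D \<sigma>"
    using transport_structure[OF wf E(1), of h] h by auto
  have sat: "satisfies \<Sigma> B \<phi> \<longleftrightarrow> satisfies \<Sigma> A \<phi>" if "sentence \<Sigma> \<phi>" for \<phi>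
    using isomorphic_satisfies[OF E(1) B(1,2) that] E(2)[OF that] by simp
  show ?thesis
  proof (intro exI[of _ B] conjI allI impI ballI)
    show "is_model \<Sigma> T B"
      using A B(1) T sat unfolding is_model_def is_theory_def by blast
    fix \<sigma> assume \<sigma>: "\<sigma> \<in> sorts \<Sigma>"
    show "|D0 \<sigma>| \<le>o |dom B \<sigma>|"
      using D[OF \<sigma>] h \<sigma> unfolding B(3)
      by (intro card_of_ordLeqI[of "h \<sigma>"]) (auto intro: inj_on_subset)
    show "|dom B \<sigma>| \<le>o |dom A \<sigma>|"
      unfolding B(3) using D[OF \<sigma>] by (intro card_of_image_ordLeq card_of_mono1) simp
    show "|dom B \<sigma>| \<le>o |K \<sigma>|"
      unfolding B(3) using h \<sigma> by (intro card_of_mono1) simp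
  qed (rule sat)
qed

theorem theorem11:
  fixes \<Sigma> :: "('s, 'f, 'p) signature"
    and \<Sigma>s :: "'s \<Rightarrow> ('s, 'f, 'p) signature"
    and T :: "('s, 'f, 'p) form set"
    and \<kappa> :: "'s \<Rightarrow> 'k rel"
  assumes "wf_signature \<Sigma>"
    and "completely_split \<Sigma> \<Sigma>s"
    and "is_theory \<Sigma> T"
    and "all_models_strongly_infinite TYPE('u) \<Sigma> T"
    and "\<forall>\<sigma> \<in> sorts \<Sigma>. Card_order (\<kappa> \<sigma>)"
    and "\<forall>\<sigma> \<in> sorts \<Sigma>. sig_card (\<Sigma>s \<sigma>) \<le>o \<kappa> \<sigma>"
    and "categorical TYPE('u) \<Sigma> \<kappa> T"
  shows "complete_theory TYPE('v) \<Sigma> T"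
proof -
  note wf = assms(1) and split = assms(2) and T = assms(3)
  have categ: "isomorphic \<Sigma> A B"
    if "is_model \<Sigma> T A" "has_cards \<Sigma> \<kappa> A" "is_model \<Sigma> T B" "has_cards \<Sigma> \<kappa> B"
    for A B :: "('s, 'f, 'p, 'u) struct"
    using assms(7) that by (simp add: categorical_def)
  obtain M :: "('s, 'f, 'p, 'u) struct" where M: "is_model \<Sigma> T M" "has_cards \<Sigma> \<kappa> M"
    using assms(7) by (auto simp: categorical_def)
  have u_infinite: "infinite (dom A \<sigma>)"
    if "is_model \<Sigma> T A" "\<sigma> \<in> sorts \<Sigma>" for A :: "('s, 'f, 'p, 'u) struct" and \<sigma>
    using assms(4) that
    by (simp add: all_models_strongly_infinite_def strongly_infinite_def infinite_natLeq_card)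
  \<comment> \<open>The domains of \<open>M\<close> represent \<kappa> by sets in \<open>'u\<close>
    and show that these cardinals are infinite, on which the count of formulas relies.\<close>
  define K where "K = dom M"
  have \<kappa>: "|K \<sigma>| =o \<kappa> \<sigma>" and K: "infinite (K \<sigma>)" if "\<sigma> \<in> sorts \<Sigma>" for \<sigma>
    using M u_infinite that by (auto simp: K_def has_cards_def)
  have card: "sig_card (\<Sigma>s \<sigma>) \<le>o |K \<sigma>|" if "\<sigma> \<in> sorts \<Sigma>" for \<sigma>
    using assms(6) that ordLeq_ordIso_trans[OF _ ordIso_symmetric[OF \<kappa>[OF that]]] by blast
  have v_infinite: "infinite (dom A \<sigma>)"
    if A: "is_model \<Sigma> T A" and \<sigma>: "\<sigma> \<in> sorts \<Sigma>" for A :: "('s, 'f, 'p, 'v) struct" and \<sigma>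
  proof -
    \<comment> \<open>One element per sort is enough: what matters is that \<open>dom B\<close> is
      no larger than \<open>dom A\<close>, while \<open>B\<close> lives in \<open>'u\<close> and so
      has infinite domains.\<close>
    define D0 where "D0 = (\<lambda>\<sigma>. {SOME a. a \<in> dom A \<sigma>})"
    have D0: "D0 \<sigma> \<subseteq> dom A \<sigma> \<and> D0 \<sigma> \<noteq> {} \<and> |D0 \<sigma>| \<le>o |K \<sigma>|" if "\<sigma> \<in> sorts \<Sigma>" for \<sigma>
      using A that K[OF that]
      by (auto simp: D0_def is_model_def is_structure_def some_in_eq intro!: card_of_singl_ordLeq)
    obtain B :: "('s, 'f, 'p, 'u) struct" where B: "is_model \<Sigma> T B"
      "\<forall>\<sigma> \<in> sorts \<Sigma>. |D0 \<sigma>| \<le>o |dom B \<sigma>| \<and> |dom B \<sigma>| \<le>o |dom A \<sigma>| \<and> |dom B \<sigma>| \<le>o |K \<sigma>|"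
      using small_equivalent_model[of \<Sigma> \<Sigma>s T A K D0, OF wf split T A K card D0] by blast
    have "|dom B \<sigma>| \<le>o |dom A \<sigma>|" using B(2) \<sigma> by simp
    then show ?thesis using u_infinite[OF B(1) \<sigma>] by (rule card_of_ordLeq_infinite)
  qed
  \<comment> \<open>Every \<open>K \<sigma>\<close> is a subset of \<open>'u\<close>, so the finite
    subsets of the whole type serve all sorts in a single ultrapower.\<close>
  obtain F :: "'u set filter" where F: "F \<le> finite_subsets_at_top UNIV" "ultra F"
    using ultra_exists[OF finite_subsets_at_top_neq_bot] by blast
  have F_bot: "F \<noteq> bot" using F(2) by (simp add: ultra_def)
  have exact: "\<exists>B :: ('s, 'f, 'p, 'u) struct. is_model \<Sigma> T B \<and> has_cards \<Sigma> \<kappa> B \<and>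
      (\<forall>\<phi>. sentence \<Sigma> \<phi> \<longrightarrow> satisfies \<Sigma> B \<phi> = satisfies \<Sigma> A \<phi>)"
    if A: "is_model \<Sigma> T A" for A :: "('s, 'f, 'p, 'v) struct"
  proof -
    define P where "P = ultrapower F A"
    have str: "is_structure \<Sigma> A" using A by (simp add: is_model_def)
    have "is_structure \<Sigma> P"
      unfolding P_def using wf unfolding wf_signature_def
      by (intro is_structure_ultrapower str F_bot) blast
    moreover have P_sat: "satisfies \<Sigma> P \<phi> = satisfies \<Sigma> A \<phi>" if "sentence \<Sigma> \<phi>" for \<phi>
      using satisfies_ultrapower[OF str _ F(2) that] calculation by (simp add: P_def)
    ultimately have P: "is_model \<Sigma> T P"
      using A T unfolding is_model_def is_theory_def by blast
    have "\<forall>\<sigma>\<in>sorts \<Sigma>. \<exists>h :: 'u \<Rightarrow> _. inj h \<and> range h \<subseteq> dom P \<sigma>"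
    proof
      fix \<sigma> assume "\<sigma> \<in> sorts \<Sigma>"
      obtain h :: "'u \<Rightarrow> _" where "inj h" "range h \<subseteq> dom P \<sigma>"
        unfolding P_def by (rule inj_into_ultrapower[OF F(1) F_bot v_infinite[OF A \<open>\<sigma> \<in> sorts \<Sigma>\<close>]])
      then show "\<exists>h :: 'u \<Rightarrow> _. inj h \<and> range h \<subseteq> dom P \<sigma>" by blast
    qed
    from bchoice[OF this] obtain h :: "'s \<Rightarrow> 'u \<Rightarrow> _"
      where h: "\<forall>\<sigma>\<in>sorts \<Sigma>. inj (h \<sigma>) \<and> range (h \<sigma>) \<subseteq> dom P \<sigma>" ..
    \<comment> \<open>By injectivity these starting sets are already as large as the upper bound on
      the hulls, which squeezes the resulting domains to \<kappa> \<sigma>.\<close>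
    have D0: "h \<sigma> ` K \<sigma> \<subseteq> dom P \<sigma> \<and> h \<sigma> ` K \<sigma> \<noteq> {} \<and> |h \<sigma> ` K \<sigma>| \<le>o |K \<sigma>|"
      if "\<sigma> \<in> sorts \<Sigma>" for \<sigma>
      using h K[OF that] that by (auto simp: card_of_image)
    obtain B :: "('s, 'f, 'p, 'u) struct" where B: "is_model \<Sigma> T B"
      "\<forall>\<phi>. sentence \<Sigma> \<phi> \<longrightarrow> satisfies \<Sigma> B \<phi> = satisfies \<Sigma> P \<phi>"
      "\<forall>\<sigma> \<in> sorts \<Sigma>. |h \<sigma> ` K \<sigma>| \<le>o |dom B \<sigma>| \<and> |dom B \<sigma>| \<le>o |dom P \<sigma>| \<and> |dom B \<sigma>| \<le>o |K \<sigma>|"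
      using small_equivalent_model[of \<Sigma> \<Sigma>s T P K "\<lambda>\<sigma>. h \<sigma> ` K \<sigma>", OF wf split T P K card D0] by blast
    have "|dom B \<sigma>| =o \<kappa> \<sigma>" if \<sigma>: "\<sigma> \<in> sorts \<Sigma>" for \<sigma>
    proof -
      have "inj_on (h \<sigma>) (K \<sigma>)" using h \<sigma> by (auto intro: inj_on_subset)
      then have "|K \<sigma>| \<le>o |h \<sigma> ` K \<sigma>|" by (intro card_of_ordLeqI) auto
      then have "|K \<sigma>| \<le>o |dom B \<sigma>|" using B(3) \<sigma> by (blast intro: ordLeq_transitive)
      then have "|dom B \<sigma>| =o |K \<sigma>|" using B(3) \<sigma> by (simp add: ordIso_iff_ordLeq)
      then show ?thesis using \<kappa>[OF \<sigma>] by (rule ordIso_transitive)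
    qed
    then show ?thesis using B(1,2) P_sat by (intro exI[of _ B]) (simp add: has_cards_def)
  qed
  have "satisfies \<Sigma> A \<phi> = satisfies \<Sigma> B \<phi>"
    if A: "is_model \<Sigma> T A" and B: "is_model \<Sigma> T B" and \<phi>: "sentence \<Sigma> \<phi>"
    for A B :: "('s, 'f, 'p, 'v) struct" and \<phi>
  proof -
    obtain A' :: "('s, 'f, 'p, 'u) struct" where A': "is_model \<Sigma> T A'" "has_cards \<Sigma> \<kappa> A'"
      "satisfies \<Sigma> A' \<phi> = satisfies \<Sigma> A \<phi>" using exact[OF A] \<phi> by blast
    obtain B' :: "('s, 'f, 'p, 'u) struct" where B': "is_model \<Sigma> T B'" "has_cards \<Sigma> \<kappa> B'"
      "satisfies \<Sigma> B' \<phi> = satisfies \<Sigma> B \<phi>" using exact[OF B] \<phi> by blast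
    have "satisfies \<Sigma> A' \<phi> = satisfies \<Sigma> B' \<phi>"
      using A'(1) B'(1) by (intro isomorphic_satisfies categ A' B' \<phi>) (simp_all add: is_model_def)
    then show ?thesis using A'(3) B'(3) by simp
  qed
  then show ?thesis
    unfolding complete_theory_def entails_def
    using satisfies_Neg_sentence unfolding is_model_def by blast
qed

end
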